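(* (i) For every positive integer $k$ there exists a sequence of finite primitive permutation groups $G_n$ of degrees $n$ (with $n$ ranging over an infinite set of positive integers, depending on $k$) such that, as $n\to\infty$, $$\frac{b(G_n)\,\log n}{\log |G_n|} \to \frac{2k}{k+1}.$$ (ii) There is an infinite sequence of finite primitive permutation groups $H_n$ of degrees $n$ (with $n$ ranging over an infinite set of positive integers) such that $$b(H_n) = \left\lfloor 2\,\frac{\log |H_n|}{\log n} \right\rceil - 2$$ for all $n$ in that set, and $b(H_n)$ is unbounded.
   Context: For a permutation group $G$ on a finite set $\Omega$ of size $n$ (the degree), a subset $\Sigma\subseteq\Omega$ is a base if the pointwise stabilizer of $\Sigma$ in $G$ is trivial; $b(G)$ is the minimal size of a base. Logarithms are to base $2$. The symbol $\lfloor x\rceil$ denotes the integer nearest to $x$. *)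

theory Defs
  imports Complex_Main "HOL-Algebra.Group_Action"
begin

text \<open>
  Permutations of \<open>\<Omega>\<close> are the elements of \<^const>\<open>BijGroup\<close>, i.e. bijections of \<open>\<Omega>\<close> that take
  the value \<^const>\<open>undefined\<close> outside \<open>\<Omega>\<close>; hence the cardinality of \<open>G\<close> is the group order.
\<close>

definition permutation_group :: "'a set \<Rightarrow> ('a \<Rightarrow> 'a) set \<Rightarrow> bool" where
  "permutation_group \<Omega> G \<longleftrightarrow> finite \<Omega> \<and> subgroup G (BijGroup \<Omega>)"

definition is_block :: "'a set \<Rightarrow> ('a \<Rightarrow> 'a) set \<Rightarrow> 'a set \<Rightarrow> bool" where
  "is_block \<Omega> G B \<longleftrightarrow> B \<subseteq> \<Omega> \<and> B \<noteq> {} \<and> (\<forall>g\<in>G. g ` B = B \<or> g ` B \<inter> B = {})"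

definition primitive_group :: "'a set \<Rightarrow> ('a \<Rightarrow> 'a) set \<Rightarrow> bool" where
  "primitive_group \<Omega> G \<longleftrightarrow>
     permutation_group \<Omega> G \<and>
     transitive_action (BijGroup \<Omega>\<lparr>carrier := G\<rparr>) \<Omega> (\<lambda>g. g) \<and>
     (\<forall>B. is_block \<Omega> G B \<longrightarrow> card B = 1 \<or> B = \<Omega>)"

definition is_base :: "'a set \<Rightarrow> ('a \<Rightarrow> 'a) set \<Rightarrow> 'a set \<Rightarrow> bool" where
  "is_base \<Omega> G \<Sigma> \<longleftrightarrow> \<Sigma> \<subseteq> \<Omega> \<and> {g \<in> G. \<forall>x\<in>\<Sigma>. g x = x} = {\<one>\<^bsub>BijGroup \<Omega>\<^esub>}"

text \<open>For a permutation group the minimum exists, since \<open>\<Omega>\<close> itself is a base.\<close>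

definition base_size :: "'a set \<Rightarrow> ('a \<Rightarrow> 'a) set \<Rightarrow> nat" where
  "base_size \<Omega> G = (LEAST m. \<exists>\<Sigma>. is_base \<Omega> G \<Sigma> \<and> card \<Sigma> = m)"

text \<open>
  A sequence of primitive groups \<open>G n\<close> of degree \<open>n\<close>, with \<open>n\<close> ranging over an infinite set \<open>N\<close>
  of positive integers; \<open>\<Omega> n\<close> is the set on which \<open>G n\<close> acts.
  Nothing is assumed about \<open>\<Omega> n\<close> and \<open>G n\<close> for \<open>n\<close> outside \<open>N\<close>.
\<close>

definition primitive_group_sequence ::
    "nat set \<Rightarrow> (nat \<Rightarrow> 'a set) \<Rightarrow> (nat \<Rightarrow> ('a \<Rightarrow> 'a) set) \<Rightarrow> bool" where
  "primitive_group_sequence N \<Omega> G \<longleftrightarrow>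
     infinite N \<and> (\<forall>n\<in>N. 0 < n \<and> card (\<Omega> n) = n \<and> primitive_group (\<Omega> n) (G n))"

end

theory Submission
  imports Defs "HOL-Library.Z2" "HOL-Library.Function_Algebras" "HOL-Library.Infinite_Set"
    "HOL-Combinatorics.Permutations" "HOL-Real_Asymp.Real_Asymp"
begin

text \<open>
  (i) Let the symmetric group of degree \<open>m\<close> act on the \<open>k\<close>-subsets of \<open>m\<close> points. A family of
  \<open>k\<close>-subsets is a base iff it separates the points. In a separating family at most one point is
  uncovered and each member has at most one private point; counting incidences gives
  \<open>b (k + 1) \<ge> 2 (m - 1)\<close>, and \<open>b (k + 1) \<le> 2 m\<close> is attained for infinitely many \<open>m\<close>. Since
  \<open>log (m choose k) \<sim> k log m\<close> and \<open>log m! \<sim> m log m\<close>, the ratio tends to \<open>2 k / (k + 1)\<close>.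

  (ii) Take the affine symplectic group of dimension \<open>2 m\<close> over the field with two elements, of
  degree \<open>4 ^ m\<close>. It is 2-transitive, its base size is \<open>2 m + 1\<close> because transvections fix
  hyperplanes pointwise, and the logarithm of its order to base \<open>4 ^ m\<close> lies in
  \<open>(m + 5/4, m + 3/2]\<close>.
\<close>

section \<open>Permutation groups from groups of transformations\<close>

locale transformation_group =
  fixes X :: "'x set" and F :: "('x \<Rightarrow> 'x) set"
  assumes finite_X: "finite X"
    and bij: "f \<in> F \<Longrightarrow> bij_betw f X X"
    and id_closed: "(\<lambda>x. x) \<in> F"
    and comp_closed: "f \<in> F \<Longrightarrow> g \<in> F \<Longrightarrow> f \<circ> g \<in> F"
    and inv_closed: "f \<in> F \<Longrightarrow> \<exists>g\<in>F. \<forall>x\<in>X. g (f x) = x"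
begin

definition separating :: "'x set \<Rightarrow> bool" where
  "separating S \<longleftrightarrow> S \<subseteq> X \<and> (\<forall>f\<in>F. (\<forall>x\<in>S. f x = x) \<longrightarrow> (\<forall>x\<in>X. f x = x))"

lemma maps_to: "f \<in> F \<Longrightarrow> x \<in> X \<Longrightarrow> f x \<in> X"
  using bij bij_betwE by blast

end

locale relabelled_group = transformation_group X F
  for X :: "'x set" and F :: "('x \<Rightarrow> 'x) set" +
  fixes Y :: "'y set" and \<beta> :: "'x \<Rightarrow> 'y"
  assumes bij_label: "bij_betw \<beta> X Y"
begin

definition relabel :: "('x \<Rightarrow> 'x) \<Rightarrow> 'y \<Rightarrow> 'y" where
  "relabel f = (\<lambda>y\<in>Y. \<beta> (f (inv_into X \<beta> y)))"

lemma label_in: "x \<in> X \<Longrightarrow> \<beta> x \<in> Y"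
  using bij_label bij_betwE by blast

lemma label_eq_iff: "x \<in> X \<Longrightarrow> y \<in> X \<Longrightarrow> \<beta> x = \<beta> y \<longleftrightarrow> x = y"
  using bij_label by (meson bij_betw_def inj_on_eq_iff)

lemma inv_label [simp]: "x \<in> X \<Longrightarrow> inv_into X \<beta> (\<beta> x) = x"
  using bij_label by (meson bij_betw_def inv_into_f_f)

lemma label_cases:
  assumes "y \<in> Y" obtains x where "x \<in> X" "y = \<beta> x"
  using assms bij_label by (metis bij_betw_def imageE)

lemma label_subset_cases:
  assumes "B \<subseteq> Y" obtains A where "A \<subseteq> X" "B = \<beta> ` A"
  using assms bij_label by (metis bij_betw_def subset_image_iff)

lemma relabel_apply [simp]: "x \<in> X \<Longrightarrow> relabel f (\<beta> x) = \<beta> (f x)"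
  by (simp add: relabel_def label_in)

lemma relabel_image: "A \<subseteq> X \<Longrightarrow> relabel f ` \<beta> ` A = \<beta> ` f ` A"
  by (auto simp: image_image intro!: image_cong)

lemma relabel_in_Bij:
  assumes "f \<in> F" shows "relabel f \<in> Bij Y"
proof -
  have "bij_betw (\<beta> \<circ> (f \<circ> inv_into X \<beta>)) Y Y"
    by (rule bij_betw_trans[OF bij_betw_trans[OF bij_betw_inv_into[OF bij_label] bij[OF assms]] bij_label])
  then have "bij_betw (relabel f) Y Y"
    by (rule bij_betw_cong[THEN iffD1, rotated]) (simp add: relabel_def)
  then show ?thesis by (simp add: Bij_def relabel_def)
qed

lemma relabel_eqI: "(\<And>x. x \<in> X \<Longrightarrow> f x = g x) \<Longrightarrow> relabel f = relabel g"
  using bij_betwE[OF bij_betw_inv_into[OF bij_label]]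
  by (simp add: relabel_def fun_eq_iff restrict_def)

lemma relabel_eqD:
  assumes "relabel f = relabel g" "f \<in> F" "g \<in> F" "x \<in> X" shows "f x = g x"
proof -
  have "\<beta> (f x) = \<beta> (g x)" using assms(1,4) by (metis relabel_apply)
  then show ?thesis using assms maps_to by (simp add: label_eq_iff)
qed

lemma compose_relabel: "g \<in> F \<Longrightarrow> compose Y (relabel f) (relabel g) = relabel (f \<circ> g)"
proof
  fix y assume g: "g \<in> F"
  show "compose Y (relabel f) (relabel g) y = relabel (f \<circ> g) y"
  proof (cases "y \<in> Y")
    case True
    then obtain x where "x \<in> X" "y = \<beta> x" by (rule label_cases)
    then show ?thesis using True g by (simp add: compose_def maps_to)
  qed (simp add: compose_def relabel_def)
qed

lemma relabel_id: "relabel (\<lambda>x. x) = \<one>\<^bsub>BijGroup Y\<^esub>"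
  by (auto simp: relabel_def BijGroup_def intro!: restrict_ext elim!: label_cases)

lemma mult_relabel:
  "f \<in> F \<Longrightarrow> g \<in> F \<Longrightarrow> relabel f \<otimes>\<^bsub>BijGroup Y\<^esub> relabel g = relabel (f \<circ> g)"
  by (simp add: BijGroup_def relabel_in_Bij compose_relabel)

lemma permutation_group_relabel: "permutation_group Y (relabel ` F)"
  unfolding permutation_group_def
proof
  show "finite Y" using finite_X bij_label bij_betw_finite by blast
  interpret G: group "BijGroup Y" by (rule group_BijGroup)
  show "subgroup (relabel ` F) (BijGroup Y)"
  proof (rule G.subgroupI)
    show "relabel ` F \<subseteq> carrier (BijGroup Y)"
      using relabel_in_Bij by (auto simp: BijGroup_def)
    show "relabel ` F \<noteq> {}" using id_closed by auto
  next
    fix a assume "a \<in> relabel ` F"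
    then obtain f where f: "f \<in> F" "a = relabel f" by auto
    obtain g where g: "g \<in> F" "\<forall>x\<in>X. g (f x) = x" using inv_closed f by blast
    have "relabel g \<otimes>\<^bsub>BijGroup Y\<^esub> a = \<one>\<^bsub>BijGroup Y\<^esub>"
      unfolding f(2) mult_relabel[OF g(1) f(1)] relabel_id[symmetric]
      by (rule relabel_eqI) (use g in auto)
    then have "inv\<^bsub>BijGroup Y\<^esub> a = relabel g"
      by (rule G.inv_equality) (use f g relabel_in_Bij in \<open>auto simp: BijGroup_def\<close>)
    then show "inv\<^bsub>BijGroup Y\<^esub> a \<in> relabel ` F" using g by simp
  next
    fix a b assume "a \<in> relabel ` F" "b \<in> relabel ` F"
    then show "a \<otimes>\<^bsub>BijGroup Y\<^esub> b \<in> relabel ` F"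
      using mult_relabel comp_closed by auto
  qed
qed

lemma primitive_group_relabel:
  assumes trans: "\<And>x y. x \<in> X \<Longrightarrow> y \<in> X \<Longrightarrow> \<exists>f\<in>F. f x = y"
    and prim: "\<And>B a b. B \<subseteq> X \<Longrightarrow> (\<And>f. f \<in> F \<Longrightarrow> f ` B = B \<or> f ` B \<inter> B = {})
      \<Longrightarrow> a \<in> B \<Longrightarrow> b \<in> B \<Longrightarrow> a \<noteq> b \<Longrightarrow> B = X"
  shows "primitive_group Y (relabel ` F)"
  unfolding primitive_group_def
proof (intro conjI allI impI)
  let ?G = "relabel ` F"
  show "permutation_group Y ?G" by (rule permutation_group_relabel)
  then have sub: "subgroup ?G (BijGroup Y)" by (simp add: permutation_group_def)
  interpret G: group "BijGroup Y" by (rule group_BijGroup)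
  have grp: "group (BijGroup Y\<lparr>carrier := ?G\<rparr>)"
    using G.subgroup_imp_group[OF sub] .
  have "group_hom (BijGroup Y\<lparr>carrier := ?G\<rparr>) (BijGroup Y) (\<lambda>g. g)"
    unfolding group_hom_def group_hom_axioms_def
    using grp group_BijGroup sub by (auto simp: hom_def dest: subgroup.mem_carrier)
  then show "transitive_action (BijGroup Y\<lparr>carrier := ?G\<rparr>) Y (\<lambda>g. g)"
  proof (intro transitive_action.intro group_action.intro transitive_action_axioms.intro)
    fix x y assume "x \<in> Y" "y \<in> Y"
    then obtain a b where ab: "a \<in> X" "b \<in> X" "x = \<beta> a" "y = \<beta> b"
      by (metis label_cases)
    obtain f where "f \<in> F" "f a = b" using trans ab by blast
    then show "\<exists>g\<in>carrier (BijGroup Y\<lparr>carrier := ?G\<rparr>). g x = y"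
      using ab by (auto intro!: bexI[of _ f])
  qed
next
  fix B assume blk: "is_block Y (relabel ` F) B"
  then have B: "B \<subseteq> Y" "B \<noteq> {}" by (simp_all add: is_block_def)
  have B_block: "relabel f ` B = B \<or> relabel f ` B \<inter> B = {}" if "f \<in> F" for f
    using blk that by (simp add: is_block_def)
  obtain A where A: "A \<subseteq> X" "B = \<beta> ` A" by (rule label_subset_cases[OF B(1)])
  have inj: "inj_on \<beta> X" using bij_label by (simp add: bij_betw_def)
  have A_block: "f ` A = A \<or> f ` A \<inter> A = {}" if "f \<in> F" for f
  proof -
    have fA: "f ` A \<subseteq> X" using A(1) maps_to[OF that] by blast
    have "\<beta> ` f ` A = \<beta> ` A \<or> \<beta> ` f ` A \<inter> \<beta> ` A = {}"
      using B_block[OF that] by (simp only: A(2) relabel_image[OF A(1)])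
    then show ?thesis
      by (simp only: inj_on_image_eq_iff[OF inj fA A(1)] inj_on_image_Int[OF inj fA A(1), symmetric]
          image_is_empty)
  qed
  show "card B = 1 \<or> B = Y"
  proof (cases "\<exists>a\<in>A. \<exists>b\<in>A. a \<noteq> b")
    case True
    then obtain a b where ab: "a \<in> A" "b \<in> A" "a \<noteq> b" by blast
    have "A = X"
    proof (rule prim[OF A(1) _ ab])
      show "f ` A = A \<or> f ` A \<inter> A = {}" if "f \<in> F" for f using that by (rule A_block)
    qed
    then show ?thesis by (simp add: A(2) bij_betw_imp_surj_on[OF bij_label])
  next
    case False
    obtain a where "a \<in> A" using B(2) unfolding A(2) by blast
    with False have "A = {a}" by blast
    then show ?thesis using A by simp
  qed
qed

lemma is_base_relabel_iff:
  assumes "S \<subseteq> X"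
  shows "is_base Y (relabel ` F) (\<beta> ` S) \<longleftrightarrow> separating S"
proof -
  have *: "(\<forall>y\<in>\<beta> ` S. relabel f y = y) \<longleftrightarrow> (\<forall>x\<in>S. f x = x)" if "f \<in> F" for f
    using assms that by (auto simp: label_eq_iff maps_to subset_iff)
  have **: "relabel f = \<one>\<^bsub>BijGroup Y\<^esub> \<longleftrightarrow> (\<forall>x\<in>X. f x = x)" if "f \<in> F" for f
    unfolding relabel_id[symmetric]
    using relabel_eqI[of f "\<lambda>x. x"] relabel_eqD[OF _ that id_closed] by blast
  have one: "\<one>\<^bsub>BijGroup Y\<^esub> \<in> relabel ` F" unfolding relabel_id[symmetric] using id_closed by blast
  have onefix: "\<forall>y\<in>\<beta> ` S. \<one>\<^bsub>BijGroup Y\<^esub> y = y"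
    unfolding relabel_id[symmetric] using *[OF id_closed] by simp
  have "\<beta> ` S \<subseteq> Y" using assms label_in by auto
  then have "is_base Y (relabel ` F) (\<beta> ` S) \<longleftrightarrow>
    (\<forall>f\<in>F. (\<forall>y\<in>\<beta> ` S. relabel f y = y) \<longrightarrow> relabel f = \<one>\<^bsub>BijGroup Y\<^esub>)"
    unfolding is_base_def using one onefix by blast
  then show ?thesis unfolding separating_def using assms * ** by auto
qed

lemma card_relabel_image: "S \<subseteq> X \<Longrightarrow> card (\<beta> ` S) = card S"
  using bij_label by (meson bij_betw_def card_image inj_on_subset)

lemma base_size_le:
  assumes "separating S" shows "base_size Y (relabel ` F) \<le> card S"
proof -
  have "S \<subseteq> X" using assms by (simp add: separating_def)
  then have "is_base Y (relabel ` F) (\<beta> ` S) \<and> card (\<beta> ` S) = card S"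
    using assms is_base_relabel_iff card_relabel_image by simp
  then show ?thesis unfolding base_size_def by (metis (mono_tags, lifting) Least_le)
qed

lemma base_size_ge:
  assumes "\<And>S. separating S \<Longrightarrow> c \<le> card S" shows "c \<le> base_size Y (relabel ` F)"
proof -
  have "separating X" by (auto simp: separating_def)
  then have "is_base Y (relabel ` F) (\<beta> ` X)" using is_base_relabel_iff by simp
  then have "\<exists>\<Sigma>. is_base Y (relabel ` F) \<Sigma> \<and> card \<Sigma> = card (\<beta> ` X)" by blast
  then have "\<exists>\<Sigma>. is_base Y (relabel ` F) \<Sigma> \<and> card \<Sigma> = base_size Y (relabel ` F)"
    unfolding base_size_def by (rule LeastI)
  then obtain \<Sigma> where S: "is_base Y (relabel ` F) \<Sigma>" "card \<Sigma> = base_size Y (relabel ` F)"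
    by blast
  then have "\<Sigma> \<subseteq> Y" by (simp add: is_base_def)
  then obtain S where S': "S \<subseteq> X" "\<Sigma> = \<beta> ` S" by (rule label_subset_cases)
  then have "separating S" using S(1) by (simp add: is_base_relabel_iff)
  then show ?thesis using assms[of S] S(2) S' by (simp add: card_relabel_image)
qed

lemma card_relabelled:
  assumes "\<And>f g. f \<in> F \<Longrightarrow> g \<in> F \<Longrightarrow> (\<And>x. x \<in> X \<Longrightarrow> f x = g x) \<Longrightarrow> f = g"
  shows "card (relabel ` F) = card F"
proof (rule card_image, rule inj_onI)
  fix f g assume "f \<in> F" "g \<in> F" "relabel f = relabel g"
  then show "f = g" using relabel_eqD[of f g] by (intro assms)
qed

end

lemma (in transformation_group) ex_primitive_group_nat:
  assumes trans: "\<And>x y. x \<in> X \<Longrightarrow> y \<in> X \<Longrightarrow> \<exists>f\<in>F. f x = y"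
    and prim: "\<And>B a b. B \<subseteq> X \<Longrightarrow> (\<And>f. f \<in> F \<Longrightarrow> f ` B = B \<or> f ` B \<inter> B = {})
      \<Longrightarrow> a \<in> B \<Longrightarrow> b \<in> B \<Longrightarrow> a \<noteq> b \<Longrightarrow> B = X"
    and ext: "\<And>f g. f \<in> F \<Longrightarrow> g \<in> F \<Longrightarrow> (\<And>x. x \<in> X \<Longrightarrow> f x = g x) \<Longrightarrow> f = g"
    and lower: "\<And>S. separating S \<Longrightarrow> c \<le> card S"
    and upper: "separating S"
  shows "\<exists>G :: (nat \<Rightarrow> nat) set. primitive_group {..<card X} G \<and> card G = card F \<and>
           c \<le> base_size {..<card X} G \<and> base_size {..<card X} G \<le> card S"
proof -
  obtain \<beta> :: "'x \<Rightarrow> nat" where "bij_betw \<beta> X {..<card X}"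
    using ex_bij_betw_finite_nat[OF finite_X] by (auto simp: atLeast0LessThan)
  then interpret R: relabelled_group X F "{..<card X}" \<beta> by unfold_locales
  have "primitive_group {..<card X} (R.relabel ` F)"
    using trans prim by (rule R.primitive_group_relabel)
  moreover have "card (R.relabel ` F) = card F"
    using ext by (rule R.card_relabelled)
  moreover have "c \<le> base_size {..<card X} (R.relabel ` F)"
    using lower by (rule R.base_size_ge)
  moreover have "base_size {..<card X} (R.relabel ` F) \<le> card S"
    using upper by (rule R.base_size_le)
  ultimately show ?thesis by (intro exI[of _ "R.relabel ` F"] conjI)
qed

section \<open>The symmetric group on subsets\<close>

lemma transpose_image_swap:
  "x \<in> B \<Longrightarrow> y \<notin> B \<Longrightarrow> transpose x y ` B = insert y (B - {x})"
  by (auto simp: transpose_def image_iff)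

lemma transpose_image_same:
  assumes "x \<in> B \<longleftrightarrow> y \<in> B" shows "transpose x y ` B = B"
  using assms by (auto simp: transpose_def image_iff)

lemma separated_family_card:
  fixes M :: "'a set"
  assumes "finite M" "finite S" and card_S: "\<And>A. A \<in> S \<Longrightarrow> A \<subseteq> M \<and> card A = k"
    and sep: "\<And>x y. x \<in> M \<Longrightarrow> y \<in> M \<Longrightarrow> (\<And>A. A \<in> S \<Longrightarrow> x \<in> A \<longleftrightarrow> y \<in> A) \<Longrightarrow> x = y"
  shows "2 * (card M - 1) \<le> card S * (k + 1)"
proof -
  define D where "D x = {A\<in>S. x \<in> A}" for x
  define E where "E = {x\<in>M. D x = {}}"
  define E' where "E' = {x\<in>M. card (D x) = 1}"
  have inj: "x = y" if "x \<in> M" "y \<in> M" "D x = D y" for x y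
    by (rule sep[OF that(1,2)]) (use that(3) in \<open>auto simp: D_def\<close>)
  have "(\<Sum>x\<in>M. card (D x)) = (\<Sum>x\<in>M. \<Sum>A\<in>S. if x \<in> A then 1 else 0)"
    unfolding D_def using assms(2) by (simp add: sum.If_cases Int_def)
  also have "\<dots> = (\<Sum>A\<in>S. \<Sum>x\<in>M. if x \<in> A then 1 else 0)" by (rule sum.swap)
  also have "\<dots> = (\<Sum>A\<in>S. k)"
  proof (rule sum.cong[OF refl])
    fix A assume "A \<in> S"
    then have "M \<inter> A = A" "card A = k" using card_S by auto
    then show "(\<Sum>x\<in>M. if x \<in> A then 1 else 0) = k" using assms(1) by (simp add: sum.If_cases)
  qed
  finally have total: "(\<Sum>x\<in>M. card (D x)) = card S * k" by simp
  have "(\<Sum>x\<in>M. 2) \<le> (\<Sum>x\<in>M. card (D x) + (if x \<in> E then 2 else 0) + (if x \<in> E' then 1 else 0))"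
  proof (rule sum_mono)
    fix x assume "x \<in> M"
    have "finite (D x)" using assms(2) by (simp add: D_def)
    then have "card (D x) = 0 \<longleftrightarrow> D x = {}" by simp
    then show "2 \<le> card (D x) + (if x \<in> E then 2 else 0) + (if x \<in> E' then 1 else 0)"
      using \<open>x \<in> M\<close> by (cases "card (D x) = 0"; cases "card (D x) = 1") (auto simp: E_def E'_def)
  qed
  also have "\<dots> = card S * k + (\<Sum>x\<in>M. if x \<in> E then 2 else 0) + (\<Sum>x\<in>M. if x \<in> E' then 1 else 0)"
    by (simp add: sum.distrib total)
  also have "(\<Sum>x\<in>M. if x \<in> E then 2 else 0) = 2 * card (M \<inter> E)"
    using assms(1) by (simp add: sum.If_cases)
  also have "(\<Sum>x\<in>M. if x \<in> E' then 1 else 0) = card (M \<inter> E')"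
    using assms(1) by (simp add: sum.If_cases)
  finally have main: "2 * card M \<le> card S * k + 2 * card (M \<inter> E) + card (M \<inter> E')" by simp
  have "card (M \<inter> E) \<le> 1"
    using assms(1) inj by (auto simp: E_def card_le_Suc0_iff_eq)
  moreover have "card (M \<inter> E') \<le> card ((\<lambda>A. {A}) ` S)"
  proof (rule card_inj_on_le)
    show "inj_on D (M \<inter> E')" using inj by (auto intro: inj_onI)
    show "D ` (M \<inter> E') \<subseteq> (\<lambda>A. {A}) ` S"
    proof clarify
      fix x assume "x \<in> E'"
      then obtain A where "D x = {A}" by (auto simp: E'_def card_1_singleton_iff)
      moreover from this have "A \<in> S" by (auto simp: D_def)
      ultimately show "D x \<in> (\<lambda>A. {A}) ` S" by simp
    qed
  qed (use assms(2) in simp)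
  moreover have "card ((\<lambda>A. {A}) ` S) = card S" by (simp add: card_image)
  ultimately show ?thesis using main by simp
qed

locale subset_action =
  fixes M :: "'a set" and k :: nat
  assumes finite_M: "finite M" and k_pos: "0 < k" and card_M: "2 * k < card M"
begin

definition subsets :: "'a set set" where
  "subsets = {A. A \<subseteq> M \<and> card A = k}"

definition induced :: "('a set \<Rightarrow> 'a set) set" where
  "induced = image ` {\<sigma>. \<sigma> permutes M}"

lemma card_subsets: "card subsets = card M choose k"
  using n_subsets[OF finite_M] by (simp add: subsets_def)

lemma in_subsetsD: "A \<in> subsets \<Longrightarrow> A \<subseteq> M" "A \<in> subsets \<Longrightarrow> card A = k" "A \<in> subsets \<Longrightarrow> finite A"
  using finite_M finite_subset by (auto simp: subsets_def)

lemma permutes_subsets: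
  assumes "\<sigma> permutes M" "A \<in> subsets" shows "\<sigma> ` A \<in> subsets"
proof -
  have "inj_on \<sigma> A" using assms(1) by (meson inj_on_subset permutes_inj subset_UNIV)
  moreover have "\<sigma> ` A \<subseteq> M" using in_subsetsD(1)[OF assms(2)] permutes_image[OF assms(1)] by blast
  ultimately show ?thesis using assms(2) by (simp add: subsets_def card_image)
qed

lemma ex_subset_separating:
  assumes "x \<in> M" "y \<noteq> x" obtains A where "A \<in> subsets" "x \<in> A" "y \<notin> A"
proof -
  have "card M \<le> card (M - {x, y}) + 2"
    using diff_card_le_card_Diff[of "{x,y}" M] assms(2) by simp
  then have "k - 1 \<le> card (M - {x, y})" using card_M by linarith
  then obtain B where B: "B \<subseteq> M - {x, y}" "card B = k - 1" "finite B"
    by (rule obtain_subset_with_card_n)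
  then have "card (insert x B) = k" using k_pos by (subst card_insert_disjoint) auto
  then show thesis using that[of "insert x B"] B assms by (auto simp: subsets_def)
qed

sublocale transformation_group subsets induced
proof
  show "finite subsets" using finite_M by (simp add: subsets_def)
  have id: "(\<lambda>A. A) = image (\<lambda>x. x)" by auto
  show "(\<lambda>A. A) \<in> induced" unfolding induced_def id by (intro imageI) (simp add: permutes_def)
next
  fix f assume "f \<in> induced"
  then obtain \<sigma> where s: "\<sigma> permutes M" "f = image \<sigma>" by (auto simp: induced_def)
  note s' = permutes_inv[OF s(1)]
  have inv: "inv_into UNIV \<sigma> ` \<sigma> ` A = A" "\<sigma> ` inv_into UNIV \<sigma> ` A = A" for A
    using permutes_inv_o[OF s(1)] by (simp_all add: image_comp)
  show "bij_betw f subsets subsets" unfolding s(2)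
    by (rule bij_betw_byWitness[where f' = "image (inv_into UNIV \<sigma>)"])
      (use permutes_subsets s s' inv in auto)
  show "\<exists>g\<in>induced. \<forall>A\<in>subsets. g (f A) = A"
    by (rule bexI[of _ "image (inv_into UNIV \<sigma>)"]) (use s s' inv in \<open>auto simp: induced_def\<close>)
next
  fix f g assume "f \<in> induced" "g \<in> induced"
  then obtain \<sigma> \<tau> where s: "\<sigma> permutes M" "f = image \<sigma>" "\<tau> permutes M" "g = image \<tau>"
    by (auto simp: induced_def)
  then have "f \<circ> g = image (\<sigma> \<circ> \<tau>)" "\<sigma> \<circ> \<tau> permutes M"
    by (auto simp: fun_eq_iff image_comp permutes_compose)
  then show "f \<circ> g \<in> induced" by (auto simp: induced_def)
qed

lemma induced_eqI:
  assumes "f \<in> induced" "g \<in> induced" "\<And>A. A \<in> subsets \<Longrightarrow> f A = g A" shows "f = g"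
proof -
  obtain \<sigma> \<tau> where s: "\<sigma> permutes M" "f = image \<sigma>" "\<tau> permutes M" "g = image \<tau>"
    using assms by (auto simp: induced_def)
  have "\<sigma> x = \<tau> x" for x
  proof (cases "x \<in> M")
    case True
    show ?thesis
    proof (rule ccontr)
      assume "\<sigma> x \<noteq> \<tau> x"
      then have "inv_into UNIV \<sigma> (\<tau> x) \<noteq> x" using s(1) by (metis permutes_inverses(1))
      then obtain A where A: "A \<in> subsets" "x \<in> A" "inv_into UNIV \<sigma> (\<tau> x) \<notin> A"
        by (rule ex_subset_separating[OF True])
      then have "\<tau> x \<in> \<sigma> ` A" using assms(3)[OF A(1)] s by auto
      then show False using A s(1) by (auto simp: permutes_inverses)
    qed
  qed (use s in \<open>simp add: permutes_not_in\<close>)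
  then show ?thesis using s by (simp add: fun_eq_iff)
qed

lemma card_induced: "card induced = fact (card M)"
proof -
  have "inj_on image {\<sigma>::'a \<Rightarrow> 'a. \<sigma> permutes M}"
  proof (rule inj_onI)
    fix \<sigma> \<tau> :: "'a \<Rightarrow> 'a" assume eq: "image \<sigma> = image \<tau>"
    have "\<sigma> ` {x} = \<tau> ` {x}" for x by (rule fun_cong[OF eq])
    then show "\<sigma> = \<tau>" by (auto simp: fun_eq_iff)
  qed
  then show ?thesis using card_permutations[OF refl finite_M] by (simp add: induced_def card_image)
qed

lemma transpose_in_induced: "x \<in> M \<Longrightarrow> y \<in> M \<Longrightarrow> image (transpose x y) \<in> induced"
  by (auto simp: induced_def permutes_swap_id)

lemma swap_closed_eq_subsets:
  assumes "\<C> \<subseteq> subsets" "A \<in> \<C>"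
    and swap: "\<And>B x y. B \<in> \<C> \<Longrightarrow> x \<in> B \<Longrightarrow> y \<in> M - B \<Longrightarrow> insert y (B - {x}) \<in> \<C>"
  shows "\<C> = subsets"
proof (intro equalityI subsetI)
  fix D assume D: "D \<in> subsets"
  have "B \<in> \<C> \<Longrightarrow> card (D - B) = n \<Longrightarrow> D \<in> \<C>" for B n
  proof (induction n arbitrary: B)
    case 0
    then have B: "B \<in> subsets" using assms by auto
    have "D \<subseteq> B" using 0 in_subsetsD(3)[OF D] by auto
    then have "D = B" using card_subset_eq[OF in_subsetsD(3)[OF B]] in_subsetsD(2) D B by metis
    then show ?case using 0 by simp
  next
    case (Suc n)
    then have B: "B \<in> subsets" using assms by auto
    have "D - B \<noteq> {}" using Suc.prems(2) by force
    then obtain y where y: "y \<in> D" "y \<notin> B" by auto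
    have "\<not> B \<subseteq> D"
      using card_subset_eq[OF in_subsetsD(3)[OF D], of B] in_subsetsD(2) D B y by auto
    then obtain x where x: "x \<in> B" "x \<notin> D" by auto
    have "insert y (B - {x}) \<in> \<C>" using swap Suc.prems(1) x y in_subsetsD(1)[OF D] by auto
    moreover have "D - insert y (B - {x}) = (D - B) - {y}" using x by auto
    moreover have "card ((D - B) - {y}) = n"
      using y Suc.prems(2) in_subsetsD(3)[OF D] by (subst card_Diff_singleton) auto
    ultimately show ?case using Suc.IH by simp
  qed
  then show "D \<in> \<C>" using assms(2) by blast
qed (use assms in auto)

lemma subsets_transitive:
  assumes A: "A \<in> subsets" and B: "B \<in> subsets" shows "\<exists>f\<in>induced. f A = B"
proof -
  have "(\<lambda>f. f A) ` induced = subsets"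
  proof (rule swap_closed_eq_subsets)
    show "(\<lambda>f. f A) ` induced \<subseteq> subsets" using maps_to A by auto
    show "A \<in> (\<lambda>f. f A) ` induced" using id_closed by force
    fix C x y assume C: "C \<in> (\<lambda>f. f A) ` induced" "x \<in> C" "y \<in> M - C"
    then obtain f where f: "f \<in> induced" "C = f A" by auto
    have "x \<in> M" using maps_to[OF f(1) A] C(2) f(2) in_subsetsD(1) by auto
    then have g: "image (transpose x y) \<in> induced" using C by (simp add: transpose_in_induced)
    have "insert y (C - {x}) = (image (transpose x y) \<circ> f) A"
      using C f by (simp add: transpose_image_swap)
    then show "insert y (C - {x}) \<in> (\<lambda>f. f A) ` induced"
      using comp_closed[OF g f(1)] by (metis imageI)
  qed
  then have "B \<in> (\<lambda>f. f A) ` induced" using B by simp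
  then show ?thesis by (elim imageE) (rule bexI, rule sym)
qed

lemma block_eq_subsets:
  assumes sub: "\<B> \<subseteq> subsets" and blk: "\<And>f. f \<in> induced \<Longrightarrow> f ` \<B> = \<B> \<or> f ` \<B> \<inter> \<B> = {}"
    and A: "A \<in> \<B>" "A' \<in> \<B>" "A \<noteq> A'"
  shows "\<B> = subsets"
proof -
  have stab: "f B \<in> \<B>" if "f \<in> induced" "C \<in> \<B>" "f C = C" "B \<in> \<B>" for f B C
    using blk[OF that(1)] that(2-4) by (metis disjoint_iff imageI)
  define nbr where
    "nbr = {C\<in>\<B>. \<exists>p\<in>C. \<exists>q\<in>M - C. insert q (C - {p}) \<in> \<B>}"
  have A_sub: "A \<in> subsets" "A' \<in> subsets" using A sub by auto
  have "\<not> A' \<subseteq> A"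
    using card_subset_eq[OF in_subsetsD(3)[OF A_sub(1)], of A'] in_subsetsD(2) A_sub A(3) by auto
  then obtain x where x: "x \<in> A'" "x \<notin> A" by auto
  have "card (A \<union> A') < card M"
    using card_Un_le[of A A'] card_M in_subsetsD(2)[OF A_sub(1)] in_subsetsD(2)[OF A_sub(2)] by linarith
  then have "\<not> M \<subseteq> A \<union> A'"
    using card_mono[of "A \<union> A'" M] in_subsetsD(3) A_sub by (metis finite_Un not_less)
  then obtain z where z: "z \<in> M" "z \<notin> A" "z \<notin> A'" by auto
  have "x \<in> M" using x A_sub in_subsetsD(1) by auto
  then have "transpose x z ` A' \<in> \<B>"
    using stab[OF transpose_in_induced A(1) _ A(2)] z x by (simp add: transpose_image_same)
  then have "insert z (A' - {x}) \<in> \<B>" using x z by (simp add: transpose_image_swap)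
  then have A'_nbr: "A' \<in> nbr" using A x z by (auto simp: nbr_def)
  have nbr_swap: "insert y (C - {x}) \<in> nbr" if C: "C \<in> nbr" and xy: "x \<in> C" "y \<in> M - C" for C x y
  proof -
    obtain p q where C: "C \<in> \<B>" and pq: "p \<in> C" "q \<in> M - C" "insert q (C - {p}) \<in> \<B>"
      using C by (auto simp: nbr_def)
    have CM: "C \<subseteq> M" using C sub in_subsetsD(1) by auto
    let ?f = "image (transpose p x) \<circ> image (transpose q y)"
    have f: "?f \<in> induced"
      using pq xy CM by (intro comp_closed transpose_in_induced) auto
    have "?f C = C" using pq xy by (simp add: transpose_image_same)
    then have "?f (insert q (C - {p})) \<in> \<B>" using stab[OF f C _ pq(3)] by blast
    moreover have "?f (insert q (C - {p})) = insert y (C - {x})"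
    proof -
      have "transpose q y ` insert q (C - {p}) = insert y (C - {p})"
      proof (cases "q = y")
        case False
        then show ?thesis using pq xy by (subst transpose_image_swap) auto
      qed simp
      also have "transpose p x ` \<dots> = insert y (C - {x})"
      proof (cases "p = x")
        case False
        then have "transpose x p ` insert y (C - {p}) = insert p (insert y (C - {p}) - {x})"
          using pq xy by (intro transpose_image_swap) auto
        then show ?thesis using pq xy False by (auto simp: transpose_commute)
      qed simp
      finally show ?thesis by simp
    qed
    ultimately have D: "insert y (C - {x}) \<in> \<B>" by simp
    moreover have "insert x (insert y (C - {x}) - {y}) = C" using xy by auto
    moreover have "x \<in> M - insert y (C - {x})" using xy CM by auto
    ultimately show ?thesis unfolding nbr_def using C
      by (intro CollectI conjI bexI[of _ y] bexI[of _ x]) auto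
  qed
  have "nbr \<subseteq> \<B>" unfolding nbr_def by blast
  moreover from this sub have "nbr \<subseteq> subsets" by (rule subset_trans)
  then have "nbr = subsets" using A'_nbr nbr_swap by (rule swap_closed_eq_subsets)
  ultimately show ?thesis using sub by (intro subset_antisym) simp_all
qed

lemma separatingI:
  assumes "S \<subseteq> subsets"
    and sep: "\<And>x y. x \<in> M \<Longrightarrow> y \<in> M \<Longrightarrow> (\<And>A. A \<in> S \<Longrightarrow> x \<in> A \<longleftrightarrow> y \<in> A) \<Longrightarrow> x = y"
  shows "separating S"
  unfolding separating_def
proof (intro conjI ballI impI)
  fix f B assume f: "f \<in> induced" "\<forall>A\<in>S. f A = A" and "B \<in> subsets"
  then obtain \<sigma> where s: "\<sigma> permutes M" "f = image \<sigma>" by (auto simp: induced_def)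
  have "\<sigma> x = x" if "x \<in> M" for x
  proof (rule sep)
    show "\<sigma> x \<in> M" using s that by (simp add: permutes_in_image)
    fix A assume "A \<in> S"
    then have "\<sigma> ` A = A" using f s by simp
    then show "\<sigma> x \<in> A \<longleftrightarrow> x \<in> A" using permutes_inj[OF s(1)] by (metis inj_image_mem_iff)
  qed (rule that)
  then have "\<sigma> ` B = id ` B" using in_subsetsD(1)[OF \<open>B \<in> subsets\<close>] by (intro image_cong) auto
  then show "f B = B" using s by simp
qed (use assms in auto)

lemma separatingD:
  assumes "separating S" and xy: "x \<in> M" "y \<in> M" "\<And>A. A \<in> S \<Longrightarrow> x \<in> A \<longleftrightarrow> y \<in> A"
  shows "x = y"
proof (rule ccontr)
  assume "x \<noteq> y"
  then obtain A where A: "A \<in> subsets" "x \<in> A" "y \<notin> A"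
    using ex_subset_separating[OF xy(1)] by metis
  have "\<forall>A\<in>S. transpose x y ` A = A" using xy(3) by (simp add: transpose_image_same)
  then have "transpose x y ` A = A"
    using assms(1) A(1) transpose_in_induced[OF xy(1,2)] unfolding separating_def by blast
  then show False using A by (auto simp: transpose_image_swap)
qed

lemma card_separating:
  assumes "separating S" shows "2 * (card M - 1) \<le> card S * (k + 1)"
proof (rule separated_family_card)
  have S: "S \<subseteq> subsets" using assms by (simp add: separating_def)
  then show "finite S" using finite_X by (rule finite_subset)
  show "A \<subseteq> M \<and> card A = k" if "A \<in> S" for A
    using that S by (auto simp: subsets_def)
qed (use finite_M separatingD[OF assms] in auto)

end

text \<open>The points of \<open>{..<t} \<times> triangle k\<close> are the vertices (\<open>p = q\<close>) and the edges (\<open>p < q\<close>) of \<open>t\<close>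
  disjoint copies of the complete graph on \<open>k\<close> vertices; \<open>star k c i\<close> consists of vertex \<open>i\<close> of
  copy \<open>c\<close> and the edges at it. Every star has one private point and all other points lie in two stars,
  which is the extremal case of the counting bound.\<close>

definition triangle :: "nat \<Rightarrow> (nat \<times> nat) set" where
  "triangle k = {(p, q). p \<le> q \<and> q < k}"

definition star :: "nat \<Rightarrow> nat \<Rightarrow> nat \<Rightarrow> (nat \<times> nat \<times> nat) set" where
  "star k c i = {c} \<times> {(p, q)\<in>triangle k. p = i \<or> q = i}"

lemma triangle_eq: "triangle k = (\<lambda>(q, p). (p, q)) ` (SIGMA q:{..<k}. {..q})"
  by (auto simp: triangle_def)

lemma finite_triangle: "finite (triangle k)"
  by (simp add: triangle_eq)

lemma card_triangle: "2 * card (triangle k) = k * (k + 1)"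
proof -
  have "card (triangle k) = (\<Sum>q<k. Suc q)"
    unfolding triangle_eq by (subst card_image) (auto simp: inj_on_def card_SigmaI)
  also have "2 * \<dots> = k * (k + 1)" by (induction k) auto
  finally show ?thesis .
qed

lemma card_star: "i < k \<Longrightarrow> card (star k c i) = k"
proof -
  assume "i < k"
  then have "bij_betw (\<lambda>j. (c, min i j, max i j)) {..<k} (star k c i)"
    by (intro bij_betw_byWitness[where f' = "\<lambda>(c, p, q). if p = i then q else p"])
      (auto simp: star_def triangle_def min_def max_def split: if_splits)
  then show ?thesis by (metis bij_betw_same_card card_lessThan)
qed

lemma star_separates:
  assumes "x \<in> {..<t} \<times> triangle k" "y \<in> {..<t} \<times> triangle k"
    and "\<And>c i. c < t \<Longrightarrow> i < k \<Longrightarrow> x \<in> star k c i \<longleftrightarrow> y \<in> star k c i"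
  shows "x = y"
proof -
  obtain c p q c' p' q' where xy: "x = (c, p, q)" "y = (c', p', q')" by (metis prod_cases3)
  have b: "c < t" "p \<le> q" "q < k" "c' < t" "p' \<le> q'" "q' < k"
    using assms xy by (auto simp: triangle_def)
  have "y \<in> star k c p" "y \<in> star k c q" "x \<in> star k c' p'" "x \<in> star k c' q'"
    using assms(3)[of c p] assms(3)[of c q] assms(3)[of c' p'] assms(3)[of c' q'] b xy
    by (auto simp: star_def triangle_def)
  then show ?thesis using xy b by (auto simp: star_def)
qed

lemma ex_subset_group:
  assumes "0 < k" "3 \<le> t" "2 * m = t * (k * (k + 1))"
  shows "\<exists>G :: (nat \<Rightarrow> nat) set. primitive_group {..<m choose k} G \<and> card G = fact m \<and>
    2 * (m - 1) \<le> base_size {..<m choose k} G * (k + 1) \<and> base_size {..<m choose k} G \<le> t * k"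
proof -
  let ?M = "{..<t} \<times> triangle k"
  have "2 * card ?M = t * (2 * card (triangle k))" by (simp add: card_cartesian_product)
  then have card_points: "card ?M = m" using card_triangle[of k] assms(3) by simp
  have "t * (k * (k + 1)) \<ge> 3 * (k * 2)"
    using assms(1,2) by (intro mult_le_mono) auto
  then interpret subset_action ?M k
    using assms card_points by unfold_locales (auto simp: finite_triangle)
  let ?S = "(\<lambda>(c, i). star k c i) ` ({..<t} \<times> {..<k})"
  have S: "separating ?S"
  proof (rule separatingI)
    show "?S \<subseteq> subsets" by (auto simp: subsets_def card_star) (auto simp: star_def)
    fix x y assume xy: "x \<in> ?M" "y \<in> ?M" "\<And>A. A \<in> ?S \<Longrightarrow> x \<in> A \<longleftrightarrow> y \<in> A"
    show "x = y" by (rule star_separates[OF xy(1,2)]) (rule xy(3), force)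
  qed
  have card_S: "card ?S \<le> t * k"
    using card_image_le[of "{..<t} \<times> {..<k}" "\<lambda>(c, i). star k c i"] by simp
  define c where "c = (2 * (m - 1) + k) div (k + 1)"
  have "c \<le> card S" if "separating S" for S
  proof -
    have "2 * (m - 1) \<le> card S * (k + 1)" using card_separating[OF that] by (simp only: card_points)
    then have "2 * (m - 1) + k < (card S + 1) * (k + 1)" by simp
    then show ?thesis unfolding c_def by (metis Suc_eq_plus1 less_Suc_eq_le less_mult_imp_div_less)
  qed
  then have "\<exists>G :: (nat \<Rightarrow> nat) set. primitive_group {..<card subsets} G \<and> card G = card induced \<and>
      c \<le> base_size {..<card subsets} G \<and> base_size {..<card subsets} G \<le> card ?S"
    using ex_primitive_group_nat[of c ?S] subsets_transitive block_eq_subsets induced_eqI S by blast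
  then obtain G :: "(nat \<Rightarrow> nat) set" where G: "primitive_group {..<m choose k} G" "card G = fact m"
    "c \<le> base_size {..<m choose k} G" "base_size {..<m choose k} G \<le> card ?S"
    unfolding card_subsets card_induced card_points by blast
  have "2 * (m - 1) \<le> c * (k + 1)"
    using div_mult_mod_eq[of "2 * (m - 1) + k" "k + 1"] mod_less_divisor[of "k + 1" "2 * (m - 1) + k"]
    unfolding c_def by linarith
  then have "2 * (m - 1) \<le> base_size {..<m choose k} G * (k + 1)"
    using G(3) by (meson le_trans mult_le_mono1)
  then show ?thesis using G card_S by (intro exI[of _ G]) auto
qed

lemma ln_fact_ge:
  assumes "0 < m" shows "real m * ln (real m) - real m \<le> ln (fact m)"
proof -
  have "real m ^ m / fact m \<le> exp (real m)"
    using sum_le_suminf[of "\<lambda>n. real m ^ n /\<^sub>R fact n" "{m}"] summable_exp_generic[of "real m"]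
    by (simp add: exp_def divide_inverse mult.commute)
  then have "real m ^ m \<le> exp (real m) * fact m" by (simp add: field_simps)
  then have "ln (real m ^ m) \<le> ln (exp (real m) * fact m)" using assms by (subst ln_le_cancel_iff) auto
  then show ?thesis using assms by (simp add: ln_mult ln_realpow)
qed

lemma ln_fact_le:
  assumes "0 < m" shows "ln (fact m) \<le> real m * ln (real m)"
proof -
  have "fact m \<le> (of_nat (m ^ m) :: real)" by (rule fact_le_power)
  then have "ln (fact m) \<le> ln (real m ^ m)" by (subst ln_le_cancel_iff) (use assms in auto)
  then show ?thesis using assms by (simp add: ln_realpow)
qed

lemma ln_choose_bounds:
  assumes "0 < k" "k \<le> m"
  shows "real k * ln (real m / real k) \<le> ln (real (m choose k))"
    "ln (real (m choose k)) \<le> real k * ln (real m)"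
proof -
  have pos: "0 < real m" "0 < real k" "0 < real (m choose k)" using assms by auto
  have "(real m / real k) ^ k \<le> real (m choose k)"
    using assms(2) by (rule binomial_ge_n_over_k_pow_k)
  then have "ln ((real m / real k) ^ k) \<le> ln (real (m choose k))"
    using pos by (subst ln_le_cancel_iff) auto
  then show "real k * ln (real m / real k) \<le> ln (real (m choose k))"
    using pos by (simp add: ln_realpow)
  have "real (m choose k) \<le> real m ^ k"
    using binomial_le_pow[OF assms(2)] by (metis of_nat_le_iff of_nat_power)
  then have "ln (real (m choose k)) \<le> ln (real m ^ k)"
    using pos by (subst ln_le_cancel_iff) auto
  then show "ln (real (m choose k)) \<le> real k * ln (real m)"
    using pos by (simp add: ln_realpow)
qed

lemma subset_group_ratio_bounds:
  fixes b k m :: nat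
  assumes "0 < k" "k < m" "4 \<le> m"
    and b: "2 * (m - 1) \<le> b * (k + 1)" "b * (k + 1) \<le> 2 * m"
  defines "r \<equiv> real b * log 2 (real (m choose k)) / log 2 (fact m)"
  shows "2 * (real m - 1) / (real k + 1) * (real k * ln (real m / real k)) / (real m * ln (real m)) \<le> r"
    and "r \<le> 2 * real m / (real k + 1) * (real k * ln (real m)) / (real m * ln (real m) - real m)"
proof -
  have r: "r = real b * ln (real (m choose k)) / ln (fact m)"
    by (simp add: r_def log_def)
  have "real (2 * (m - 1)) \<le> real (b * (k + 1))" "real (b * (k + 1)) \<le> real (2 * m)"
    using b by (simp_all only: of_nat_le_iff)
  then have b': "2 * (real m - 1) / (real k + 1) \<le> real b" "real b \<le> 2 * real m / (real k + 1)"
    using assms(3) by (simp_all add: field_simps of_nat_diff)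
  have "ln (exp 1) < ln (real m)"
    using assms(3) exp_le by (subst ln_less_cancel_iff) auto
  then have ln_m: "1 < ln (real m)" by simp
  then have pos: "0 < real m * ln (real m) - real m" using assms(3) by (simp add: field_simps)
  have fact: "real m * ln (real m) - real m \<le> ln (fact m)" "ln (fact m) \<le> real m * ln (real m)"
    using ln_fact_ge[of m] ln_fact_le[of m] assms(3) by auto
  note choose = ln_choose_bounds[of k m]
  have ln_k: "0 \<le> ln (real m / real k)" using assms(1,2) by (intro ln_ge_zero) simp
  have ln_choose: "0 \<le> ln (real (m choose k))"
    using assms(1,2) by (intro order_trans[OF _ choose(1)] mult_nonneg_nonneg ln_k) auto
  have ln_fact: "0 < ln (fact m :: real)" using pos fact(1) by linarith
  show "2 * (real m - 1) / (real k + 1) * (real k * ln (real m / real k)) / (real m * ln (real m)) \<le> r"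
    unfolding r
    by (intro frac_le mult_mono b' choose fact) (use assms(1-3) ln_k ln_choose ln_fact in auto)
  show "r \<le> 2 * real m / (real k + 1) * (real k * ln (real m)) / (real m * ln (real m) - real m)"
    unfolding r
    by (intro frac_le mult_mono b' choose fact) (use assms(1-3) ln_m ln_choose pos in auto)
qed

lemma subset_group_sequence:
  fixes k :: nat
  assumes k: "0 < k"
  shows "\<exists>(N :: nat set) (\<Omega> :: nat \<Rightarrow> nat set) (G :: nat \<Rightarrow> (nat \<Rightarrow> nat) set).
           primitive_group_sequence N \<Omega> G \<and>
           ((\<lambda>n. real (base_size (\<Omega> n) (G n)) * log 2 (real n) / log 2 (real (card (G n))))
              \<longlongrightarrow> 2 * real k / (real k + 1)) (inf at_top (principal N))"
proof -
  define M where "M t = t * (k * (k + 1))" for t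
  define N where "N = (\<lambda>t. M t choose k) ` {2..}"
  define F where "F = inf at_top (principal N)"
  have M: "t \<le> M t" "2 \<le> t \<Longrightarrow> k < M t" "2 \<le> t \<Longrightarrow> 4 \<le> M t" for t
  proof -
    have kk: "1 * 2 \<le> k * (k + 1)" "k * 2 \<le> k * (k + 1)" using k by (intro mult_le_mono; simp)+
    show "t \<le> M t" using kk(1) unfolding M_def by simp
    show "2 \<le> t \<Longrightarrow> k < M t" using mult_le_mono[OF _ kk(2), of 2 t] k unfolding M_def by simp
    show "2 \<le> t \<Longrightarrow> 4 \<le> M t" using mult_le_mono[OF _ kk(1), of 2 t] unfolding M_def by simp
  qed
  have "\<exists>G t. 2 \<le> t \<and> n = M t choose k \<and> primitive_group {..<n} G \<and> card G = fact (M t) \<and>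
      2 * (M t - 1) \<le> base_size {..<n} G * (k + 1) \<and> base_size {..<n} G * (k + 1) \<le> 2 * M t"
    if n: "n \<in> N" for n
  proof -
    obtain t where t: "2 \<le> t" "n = M t choose k" using n by (auto simp: N_def)
    have "3 \<le> 2 * t" "2 * M t = 2 * t * (k * (k + 1))" using t by (auto simp: M_def)
    from ex_subset_group[OF k this]
    obtain G :: "(nat \<Rightarrow> nat) set" where G: "primitive_group {..<n} G" "card G = fact (M t)"
      "2 * (M t - 1) \<le> base_size {..<n} G * (k + 1)" "base_size {..<n} G \<le> 2 * t * k"
      unfolding t(2) by blast
    have "base_size {..<n} G * (k + 1) \<le> 2 * M t"
      using mult_le_mono1[OF G(4), of "k + 1"] by (simp add: M_def algebra_simps)
    then show ?thesis using G t by blast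
  qed
  then obtain G \<tau> where G: "\<And>n. n \<in> N \<Longrightarrow> 2 \<le> \<tau> n \<and> n = M (\<tau> n) choose k \<and>
      primitive_group {..<n} (G n :: (nat \<Rightarrow> nat) set) \<and> card (G n) = fact (M (\<tau> n)) \<and>
      2 * (M (\<tau> n) - 1) \<le> base_size {..<n} (G n) * (k + 1) \<and>
      base_size {..<n} (G n) * (k + 1) \<le> 2 * M (\<tau> n)"
    by metis
  have "infinite N"
  proof (unfold infinite_nat_iff_unbounded_le, intro allI)
    fix t :: nat
    let ?t = "t + 2"
    have "M ?t = ?t * (k + 1) * k" unfolding M_def by (simp only: mult_ac)
    then have "real (M ?t) / real k = real (?t * (k + 1))"
      using k by (simp only: of_nat_mult) simp
    then have "real (?t * (k + 1)) ^ k \<le> real (M ?t choose k)"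
      using binomial_ge_n_over_k_pow_k[of k "M ?t", where 'a = real] M(2)[of ?t] by simp
    then have "(?t * (k + 1)) ^ k \<le> M ?t choose k"
      by (metis of_nat_le_iff of_nat_power)
    moreover have "?t * (k + 1) \<le> (?t * (k + 1)) ^ k" using k by (intro self_le_power) auto
    moreover have "t \<le> ?t * (k + 1)" by simp
    ultimately have "t \<le> M ?t choose k" by linarith
    then show "\<exists>n\<ge>t. n \<in> N" unfolding N_def by (intro exI[of _ "M ?t choose k"]) auto
  qed
  then have seq: "primitive_group_sequence N (\<lambda>n. {..<n}) G"
    unfolding primitive_group_sequence_def using G M(2)
    by (metis card_lessThan less_imp_le zero_less_binomial)
  have in_N: "eventually (\<lambda>n. n \<in> N) F"
    unfolding F_def by (simp add: eventually_inf_principal)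
  have "filterlim \<tau> at_top F"
    unfolding filterlim_at_top
  proof
    fix Z
    have "{n\<in>N. \<tau> n < Z} \<subseteq> (\<lambda>t. M t choose k) ` {..<Z}" using G by blast
    then have "finite {n\<in>N. \<tau> n < Z}" by (rule finite_subset) simp
    then obtain K where "\<forall>n\<in>{n\<in>N. \<tau> n < Z}. n < K" by (auto simp: finite_nat_set_iff_bounded)
    then show "eventually (\<lambda>n. Z \<le> \<tau> n) F"
      unfolding F_def eventually_inf_principal
      by (intro eventually_at_top_linorderI[of K]) (force simp: not_less[symmetric])
  qed
  then have "filterlim (\<lambda>n. M (\<tau> n)) at_top F"
    by (rule filterlim_at_top_mono) (simp add: M(1))
  then have lim: "filterlim (\<lambda>n. real (M (\<tau> n))) at_top F"
    by (rule filterlim_compose[OF filterlim_real_sequentially])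
  have k': "0 < real k" using k by simp
  have val: "2 * inverse (real k + 1) * real k = 2 * real k / (real k + 1)" by (simp add: field_simps)
  have "((\<lambda>x. 2 * (x - 1) / (real k + 1) * (real k * ln (x / real k)) / (x * ln x))
      \<longlongrightarrow> 2 * inverse (real k + 1) * real k) at_top"
    using k' by real_asymp
  from filterlim_compose[OF this lim]
  have lower: "((\<lambda>n. 2 * (real (M (\<tau> n)) - 1) / (real k + 1) * (real k * ln (real (M (\<tau> n)) / real k)) /
      (real (M (\<tau> n)) * ln (real (M (\<tau> n))))) \<longlongrightarrow> 2 * real k / (real k + 1)) F"
    unfolding val .
  have "((\<lambda>x. 2 * x / (real k + 1) * (real k * ln x) / (x * ln x - x))
      \<longlongrightarrow> 2 * inverse (real k + 1) * real k) at_top"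
    using k' by real_asymp
  from filterlim_compose[OF this lim]
  have upper: "((\<lambda>n. 2 * real (M (\<tau> n)) / (real k + 1) * (real k * ln (real (M (\<tau> n)))) /
      (real (M (\<tau> n)) * ln (real (M (\<tau> n))) - real (M (\<tau> n)))) \<longlongrightarrow> 2 * real k / (real k + 1)) F"
    unfolding val .
  have ratio: "real (base_size {..<n} (G n)) * log 2 (real n) / log 2 (real (card (G n))) =
      real (base_size {..<n} (G n)) * log 2 (real (M (\<tau> n) choose k)) / log 2 (fact (M (\<tau> n)))"
    if "n \<in> N" for n
    using G[OF that] by (metis of_nat_fact)
  have "((\<lambda>n. real (base_size {..<n} (G n)) * log 2 (real n) / log 2 (real (card (G n))))
      \<longlongrightarrow> 2 * real k / (real k + 1)) F"
  proof (rule tendsto_sandwich[OF _ _ lower upper])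
    show "eventually (\<lambda>n. 2 * (real (M (\<tau> n)) - 1) / (real k + 1) * (real k * ln (real (M (\<tau> n)) / real k)) /
        (real (M (\<tau> n)) * ln (real (M (\<tau> n))))
      \<le> real (base_size {..<n} (G n)) * log 2 (real n) / log 2 (real (card (G n)))) F"
      using in_N
    proof eventually_elim
      case (elim n)
      show ?case unfolding ratio[OF elim]
        by (rule subset_group_ratio_bounds(1)) (use G[OF elim] M k in auto)
    qed
    show "eventually (\<lambda>n. real (base_size {..<n} (G n)) * log 2 (real n) / log 2 (real (card (G n)))
      \<le> 2 * real (M (\<tau> n)) / (real k + 1) * (real k * ln (real (M (\<tau> n)))) /
        (real (M (\<tau> n)) * ln (real (M (\<tau> n))) - real (M (\<tau> n)))) F"
      using in_N
    proof eventually_elim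
      case (elim n)
      show ?case unfolding ratio[OF elim]
        by (rule subset_group_ratio_bounds(2)) (use G[OF elim] M k in auto)
    qed
  qed
  then show ?thesis using seq unfolding F_def by blast
qed

section \<open>The affine symplectic group over the field with two elements\<close>

lemma card_orbit_mult_card_stabilizer:
  fixes F :: "('a \<Rightarrow> 'a) set"
  assumes bij: "\<And>f. f \<in> F \<Longrightarrow> bij f"
    and comp: "\<And>f g. f \<in> F \<Longrightarrow> g \<in> F \<Longrightarrow> f \<circ> g \<in> F"
    and inv: "\<And>f. f \<in> F \<Longrightarrow> inv_into UNIV f \<in> F"
  shows "card F = card ((\<lambda>f. f x) ` F) * card {f\<in>F. f x = x}"
proof -
  have "\<exists>h\<in>F. h x = y" if "y \<in> (\<lambda>f. f x) ` F" for y using that by auto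
  then obtain h where h: "\<And>y. y \<in> (\<lambda>f. f x) ` F \<Longrightarrow> h y \<in> F \<and> h y x = y" by metis
  have inv_h: "inv_into UNIV (h y) y = x" if "y \<in> (\<lambda>f. f x) ` F" for y
    using h[OF that] bij by (metis bij_inv_eq_iff)
  have "bij_betw (\<lambda>(y, s). h y \<circ> s) (((\<lambda>f. f x) ` F) \<times> {f\<in>F. f x = x}) F"
  proof (rule bij_betw_byWitness[where f' = "\<lambda>f. (f x, inv_into UNIV (h (f x)) \<circ> f)"])
    show "\<forall>a\<in>(\<lambda>f. f x) ` F \<times> {f \<in> F. f x = x}.
        (\<lambda>f. (f x, inv_into UNIV (h (f x)) \<circ> f)) (case a of (y, s) \<Rightarrow> h y \<circ> s) = a"
      using h bij by (auto simp: o_assoc bij_is_inj)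
    show "\<forall>f\<in>F. (case (f x, inv_into UNIV (h (f x)) \<circ> f) of (y, s) \<Rightarrow> h y \<circ> s) = f"
      using h bij by (auto simp: fun_eq_iff bij_is_surj surj_f_inv_f)
    show "(\<lambda>(y, s). h y \<circ> s) ` ((\<lambda>f. f x) ` F \<times> {f \<in> F. f x = x}) \<subseteq> F"
      using h comp by auto
    show "(\<lambda>f. (f x, inv_into UNIV (h (f x)) \<circ> f)) ` F \<subseteq> (\<lambda>f. f x) ` F \<times> {f \<in> F. f x = x}"
      using h comp inv inv_h by auto
  qed
  from bij_betw_same_card[OF this] show ?thesis by (simp add: card_cartesian_product)
qed

declare add_bit_eq_xor [simp del] mult_bit_eq_and [simp del]

lemma bit_add_self [simp]: "(a::bit) + a = 0"
  by (cases a) simp_all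

lemma bit_add_self_left [simp]: "(a::bit) + (a + b) = b"
  by (simp flip: add.assoc)

lemma bit_vec_add_self [simp]: "(x :: 'a \<Rightarrow> bit) + x = 0" "x + (x + y) = y"
  by (simp_all add: fun_eq_iff)

lemma bit_vec_add_eq_0_iff [simp]: "(x :: 'a \<Rightarrow> bit) + y = 0 \<longleftrightarrow> x = y"
proof
  assume "x + y = 0"
  then have "x + (x + y) = x" by simp
  then show "x = y" by (simp only: bit_vec_add_self)
qed simp

lemma card_bit_vec:
  fixes c :: "'a \<Rightarrow> bit"
  assumes "finite I"
  shows "finite {x. \<forall>i. i \<notin> I \<longrightarrow> x i = c i}" "card {x. \<forall>i. i \<notin> I \<longrightarrow> x i = c i} = 2 ^ card I"
proof -
  have *: "bij_betw (\<lambda>A i. if i \<in> I then of_bool (i \<in> A) else c i) (Pow I)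
    {x. \<forall>i. i \<notin> I \<longrightarrow> x i = c i}"
    by (rule bij_betw_byWitness[where f' = "\<lambda>x. {i\<in>I. x i = 1}"]) (auto simp: fun_eq_iff)
  show "finite {x. \<forall>i. i \<notin> I \<longrightarrow> x i = c i}"
    using bij_betw_finite[OF *] assms by simp
  show "card {x. \<forall>i. i \<notin> I \<longrightarrow> x i = c i} = 2 ^ card I"
    using bij_betw_same_card[OF *] assms by (simp add: card_Pow)
qed

definition partner :: "nat \<Rightarrow> nat" where
  "partner j = (if even j then Suc j else j - 1)"

lemma partner_partner [simp]: "partner (partner j) = j"
  by (auto simp: partner_def elim!: oddE)

lemma partner_less_double_iff [simp]: "partner j < 2 * m \<longleftrightarrow> j < 2 * m"
  by (auto simp: partner_def elim!: evenE oddE)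

definition unit_vec :: "nat \<Rightarrow> nat \<Rightarrow> bit" where
  "unit_vec j = (\<lambda>i. of_bool (i = j))"

lemma unit_vec_apply: "unit_vec j i = of_bool (i = j)"
  by (simp add: unit_vec_def)

locale symplectic_space =
  fixes m :: nat
begin

definition V :: "(nat \<Rightarrow> bit) set" where
  "V = {x. \<forall>i\<ge>2*m. x i = 0}"

definition form :: "(nat \<Rightarrow> bit) \<Rightarrow> (nat \<Rightarrow> bit) \<Rightarrow> bit" where
  "form x y = (\<Sum>i<m. x (2*i) * y (Suc (2*i)) + x (Suc (2*i)) * y (2*i))"

text \<open>The sum of the form over the sides of a triangle. It is unchanged by translations, and a
  permutation fixing 0 and preserving it preserves the form, hence is linear: its automorphisms
  are exactly the affine symplectic maps.\<close>

definition area :: "(nat \<Rightarrow> bit) \<Rightarrow> (nat \<Rightarrow> bit) \<Rightarrow> (nat \<Rightarrow> bit) \<Rightarrow> bit" where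
  "area x y z = form x y + form y z + form z x"

definition affine_symplectic :: "((nat \<Rightarrow> bit) \<Rightarrow> (nat \<Rightarrow> bit)) set" where
  "affine_symplectic = {f. f permutes V \<and> (\<forall>x\<in>V. \<forall>y\<in>V. \<forall>z\<in>V. area (f x) (f y) (f z) = area x y z)}"

definition stab :: "(nat \<Rightarrow> bit) set \<Rightarrow> ((nat \<Rightarrow> bit) \<Rightarrow> (nat \<Rightarrow> bit)) set" where
  "stab S = {f\<in>affine_symplectic. \<forall>s\<in>S. f s = s}"

definition transvection :: "(nat \<Rightarrow> bit) \<Rightarrow> (nat \<Rightarrow> bit) \<Rightarrow> (nat \<Rightarrow> bit) \<Rightarrow> nat \<Rightarrow> bit" where
  "transvection p w x = (if x \<in> V \<and> form (x + p) w = 1 then x + w else x)"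

definition translation :: "(nat \<Rightarrow> bit) \<Rightarrow> (nat \<Rightarrow> bit) \<Rightarrow> nat \<Rightarrow> bit" where
  "translation v x = (if x \<in> V then x + v else x)"

definition flag :: "nat \<Rightarrow> (nat \<Rightarrow> bit) set" where
  "flag j = insert 0 (unit_vec ` {..<2*j})"

definition perp :: "nat \<Rightarrow> (nat \<Rightarrow> bit) set" where
  "perp j = {x\<in>V. \<forall>i<2*j. x i = 0}"

lemma zero_in_V [simp]: "0 \<in> V" and add_in_V [simp]: "x \<in> V \<Longrightarrow> y \<in> V \<Longrightarrow> x + y \<in> V"
  by (auto simp: V_def)

lemma unit_vec_in_V: "j < 2*m \<Longrightarrow> unit_vec j \<in> V"
  by (auto simp: V_def unit_vec_def)

lemma V_eq: "V = {x. \<forall>i. i \<notin> {..<2*m} \<longrightarrow> x i = 0}"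
  by (auto simp: V_def not_less)

lemma finite_V [simp]: "finite V" and card_V: "card V = 2 ^ (2*m)"
  using card_bit_vec[of "{..<2*m}" "\<lambda>_. 0"] by (simp_all add: V_eq)

lemma form_add: "form (x + y) z = form x z + form y z" "form z (x + y) = form z x + form z y"
  by (simp_all add: form_def algebra_simps sum.distrib)

lemma form_sym: "form x y = form y x"
  by (simp add: form_def ac_simps)

lemma form_self [simp]: "form x x = 0"
  by (simp add: form_def mult.commute)

lemma form_zero [simp]: "form 0 x = 0" "form x 0 = 0"
  by (simp_all add: form_def)

lemma form_unit_vec: "j < 2*m \<Longrightarrow> form x (unit_vec j) = x (partner j)"
proof (cases "even j")
  case True
  then obtain i where i: "j = 2*i" by (elim evenE)
  assume "j < 2*m"
  have "form x (unit_vec j) = (\<Sum>l<m. if l = i then x (Suc (2*l)) else 0)"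
    unfolding form_def unit_vec_def i by (intro sum.cong refl) (simp add: Suc_double_not_eq_double double_not_eq_Suc_double)
  then show ?thesis using \<open>j < 2*m\<close> i by (simp add: partner_def)
next
  case False
  then obtain i where i: "j = Suc (2*i)" by (auto elim!: oddE)
  assume "j < 2*m"
  have "form x (unit_vec j) = (\<Sum>l<m. if l = i then x (2*l) else 0)"
    unfolding form_def unit_vec_def i by (intro sum.cong refl) (simp add: Suc_double_not_eq_double double_not_eq_Suc_double)
  then show ?thesis using \<open>j < 2*m\<close> i by (simp add: partner_def)
qed

lemma form_nondegenerate:
  assumes "x \<in> V" "y \<in> V" "\<And>j. j < 2*m \<Longrightarrow> form x (unit_vec j) = form y (unit_vec j)"
  shows "x = y"
proof
  fix i show "x i = y i"
  proof (cases "i < 2*m")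
    case True
    then show ?thesis using assms(3)[of "partner i"] by (simp add: form_unit_vec)
  qed (use assms in \<open>auto simp: V_def\<close>)
qed

lemma perp_subset: "perp j \<subseteq> V" by (auto simp: perp_def)

lemma perp_add: "x \<in> perp j \<Longrightarrow> y \<in> perp j \<Longrightarrow> x + y \<in> perp j"
  by (auto simp: perp_def)

lemma unit_vec_in_perp: "2*j \<le> i \<Longrightarrow> i < 2*m \<Longrightarrow> unit_vec i \<in> perp j"
  by (auto simp: perp_def unit_vec_in_V unit_vec_apply)

lemma form_flag_perp: "j \<le> m \<Longrightarrow> s \<in> flag j \<Longrightarrow> w \<in> perp j \<Longrightarrow> form s w = 0"
  unfolding form_sym[of s] by (auto simp: flag_def perp_def form_unit_vec)

lemma in_perpI: "j \<le> m \<Longrightarrow> w \<in> V \<Longrightarrow> (\<And>i. i < 2*j \<Longrightarrow> form w (unit_vec i) = 0) \<Longrightarrow> w \<in> perp j"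
  unfolding perp_def
proof (clarify)
  fix i assume *: "j \<le> m" "\<And>i. i < 2*j \<Longrightarrow> form w (unit_vec i) = 0" "i < 2*j"
  then show "w i = 0" using *(2)[of "partner i"] by (simp add: form_unit_vec)
qed

lemma ex_form_one:
  assumes "x \<in> perp j" "x \<noteq> 0"
  obtains z where "z \<in> perp j" "form x z = 1"
proof -
  obtain i where i: "x i = 1" using assms(2) by (auto simp: fun_eq_iff)
  then have "\<not> i < 2*j" "i < 2*m" using assms(1) by (auto simp: perp_def V_def not_less[symmetric])
  then have *: "\<not> partner i < 2*j" "partner i < 2*m" by simp_all
  then have "unit_vec (partner i) \<in> perp j" by (intro unit_vec_in_perp) (simp_all only: not_less)
  then show thesis using that i form_unit_vec[OF *(2)] by simp
qed

lemma ex_form_one_both: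
  assumes "x \<in> perp j" "x \<noteq> 0" "y \<in> perp j" "y \<noteq> 0"
  obtains z where "z \<in> perp j" "form x z = 1" "form y z = 1"
proof -
  obtain a where a: "a \<in> perp j" "form x a = 1" by (rule ex_form_one[OF assms(1,2)])
  obtain b where b: "b \<in> perp j" "form y b = 1" by (rule ex_form_one[OF assms(3,4)])
  consider "form y a = 1" | "form x b = 1" | "form y a = 0" "form x b = 0" by fastforce
  then show thesis
  proof cases
    case 3
    then show ?thesis using that[of "a + b"] a b by (simp add: form_add perp_add)
  qed (use that a b in auto)
qed

lemma affine_symplecticI:
  assumes "\<And>x. x \<in> V \<Longrightarrow> f x \<in> V" "\<And>x. x \<in> V \<Longrightarrow> f (f x) = x" "\<And>x. x \<notin> V \<Longrightarrow> f x = x"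
    and "\<And>x y z. x \<in> V \<Longrightarrow> y \<in> V \<Longrightarrow> z \<in> V \<Longrightarrow> area (f x) (f y) (f z) = area x y z"
  shows "f \<in> affine_symplectic"
proof -
  have "bij_betw f V V" using assms(1,2) by (intro bij_betw_byWitness[where f' = f]) auto
  then have "f permutes V" using assms(3) by (rule bij_imp_permutes)
  then show ?thesis using assms(4) by (simp add: affine_symplectic_def)
qed

lemma area_eq: "area x y z = form (x + z) (y + z)"
  by (simp add: area_def form_add form_sym[of z] ac_simps)

lemma translation_in: "v \<in> V \<Longrightarrow> translation v \<in> affine_symplectic"
proof (rule affine_symplecticI)
  fix x y z assume "v \<in> V" "x \<in> V" "y \<in> V" "z \<in> V"
  then show "area (translation v x) (translation v y) (translation v z) = area x y z"
    by (simp add: translation_def area_eq ac_simps)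
qed (auto simp: translation_def add.assoc)

lemma transvection_in:
  assumes "w \<in> V" shows "transvection p w \<in> affine_symplectic"
proof (rule affine_symplecticI)
  fix x y z assume V: "x \<in> V" "y \<in> V" "z \<in> V"
  define c where "c x = form (x + p) w" for x
  have c: "form x w = c x + form p w" for x by (simp add: c_def form_add)
  have f: "form (transvection p w x) u = form x u + c x * form w u"
    "form u (transvection p w x) = form u x + c x * form w u" if "x \<in> V" for u x
    using that by (cases "c x"; simp add: transvection_def form_add c_def form_sym[of u])+
  show "area (transvection p w x) (transvection p w y) (transvection p w z) = area x y z"
    unfolding area_def f[OF V(1)] f[OF V(2)] f[OF V(3)]
    by (simp add: form_sym[of w] c[of x] c[of y] c[of z] algebra_simps)
qed (use assms in \<open>auto simp: transvection_def form_add add.assoc\<close>)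

lemma affine_symplectic_bij: "f \<in> affine_symplectic \<Longrightarrow> bij f"
  by (auto simp: affine_symplectic_def permutes_bij)

lemma affine_symplectic_in_V: "f \<in> affine_symplectic \<Longrightarrow> f x \<in> V \<longleftrightarrow> x \<in> V"
  by (auto simp: affine_symplectic_def permutes_in_image)

lemma affine_symplectic_comp: "f \<in> affine_symplectic \<Longrightarrow> g \<in> affine_symplectic \<Longrightarrow> f \<circ> g \<in> affine_symplectic"
  by (auto simp: affine_symplectic_def permutes_compose permutes_in_image)

lemma affine_symplectic_inv:
  assumes "f \<in> affine_symplectic" shows "inv_into UNIV f \<in> affine_symplectic"
proof -
  have f: "f permutes V" using assms by (simp add: affine_symplectic_def)
  have "area (inv_into UNIV f x) (inv_into UNIV f y) (inv_into UNIV f z) = area x y z" if "x \<in> V" "y \<in> V" "z \<in> V" for x y z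
  proof -
    have "inv_into UNIV f x \<in> V" "inv_into UNIV f y \<in> V" "inv_into UNIV f z \<in> V"
      using that permutes_in_image[OF permutes_inv[OF f]] by auto
    then have "area (f (inv_into UNIV f x)) (f (inv_into UNIV f y)) (f (inv_into UNIV f z)) = area (inv_into UNIV f x) (inv_into UNIV f y) (inv_into UNIV f z)"
      using assms by (simp add: affine_symplectic_def)
    then show ?thesis by (simp add: permutes_inverses(1)[OF f])
  qed
  then show ?thesis using permutes_inv[OF f] by (simp add: affine_symplectic_def)
qed

lemma id_in_affine_symplectic: "(\<lambda>x. x) \<in> affine_symplectic"
  by (rule affine_symplecticI) auto

lemma stab_comp: "f \<in> stab S \<Longrightarrow> g \<in> stab S \<Longrightarrow> f \<circ> g \<in> stab S"
  by (auto simp: stab_def affine_symplectic_comp)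

lemma stab_inv:
  assumes "f \<in> stab S" shows "inv_into UNIV f \<in> stab S"
proof -
  have f: "f \<in> affine_symplectic" "\<And>s. s \<in> S \<Longrightarrow> f s = s" using assms by (auto simp: stab_def)
  then have "inv_into UNIV f s = s" if "s \<in> S" for s
    using that inv_f_f[OF bij_is_inj[OF affine_symplectic_bij[OF f(1)]], of s] by simp
  then show ?thesis using f(1) by (simp add: stab_def affine_symplectic_inv)
qed

lemma stab_bij: "f \<in> stab S \<Longrightarrow> bij f"
  by (simp add: stab_def affine_symplectic_bij)

lemma stab_insert: "stab (insert x S) = {f\<in>stab S. f x = x}"
  by (auto simp: stab_def)

lemma card_stab:
  "card (stab S) = card ((\<lambda>f. f x) ` stab S) * card (stab (insert x S))"
  unfolding stab_insert
  by (rule card_orbit_mult_card_stabilizer) (rule stab_bij stab_comp stab_inv; assumption)+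

lemma stab_form:
  assumes "f \<in> stab S" "0 \<in> S" "x \<in> V" "y \<in> V" shows "form (f x) (f y) = form x y"
proof -
  have "area (f x) (f y) (f 0) = area x y 0"
    using assms zero_in_V unfolding stab_def affine_symplectic_def by blast
  moreover have "f 0 = 0" using assms by (simp add: stab_def)
  ultimately show ?thesis by (simp add: area_def)
qed

lemma transvection_in_stab:
  assumes "w \<in> V" "\<And>s. s \<in> S \<Longrightarrow> form s w = 0" shows "transvection 0 w \<in> stab S"
  using assms transvection_in by (auto simp: stab_def transvection_def)

lemma stab_transitive:
  assumes "\<And>s w. s \<in> S \<Longrightarrow> w \<in> perp j \<Longrightarrow> form s w = 0"
    and x: "x \<in> perp j" "x \<noteq> 0" and y: "y \<in> perp j" "y \<noteq> 0"
  obtains f where "f \<in> stab S" "f x = y"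
proof -
  obtain z where z: "z \<in> perp j" "form x z = 1" "form y z = 1"
    by (rule ex_form_one_both[OF x y])
  let ?f = "transvection 0 (z + y)" and ?g = "transvection 0 (x + z)"
  have V: "x \<in> V" "z \<in> V" "y \<in> V" using x y z perp_subset by auto
  have "?f \<in> stab S" "?g \<in> stab S"
    using V by (auto intro!: transvection_in_stab assms(1) perp_add x y z)
  then have "?f \<circ> ?g \<in> stab S" by (rule stab_comp)
  moreover have "?g x = z" using V z by (simp add: transvection_def form_add)
  moreover have "?f z = y" using V z by (simp add: transvection_def form_add form_sym[of z])
  ultimately show thesis using that[of "?f \<circ> ?g"] by simp
qed

lemma orbit_zero: "(\<lambda>f. f 0) ` affine_symplectic = V"
proof (intro equalityI subsetI)
  fix v assume "v \<in> V"
  then show "v \<in> (\<lambda>f. f 0) ` affine_symplectic"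
    by (intro image_eqI[OF _ translation_in[of v]]) (simp_all add: translation_def)
qed (auto simp: affine_symplectic_in_V)

lemma stab_flag_perp:
  assumes "j \<le> m" "flag j \<subseteq> S" "f \<in> stab S" "x \<in> perp j" shows "f x \<in> perp j"
proof (rule in_perpI[OF assms(1)])
  have "x \<in> V" using assms perp_subset by auto
  then show "f x \<in> V" using assms by (auto simp: stab_def affine_symplectic_in_V)
  fix i assume i: "i < 2*j"
  then have u: "unit_vec i \<in> flag j" "unit_vec i \<in> V" using assms(1)
    by (auto simp: flag_def unit_vec_in_V)
  have "0 \<in> S" using assms by (auto simp: flag_def)
  have "form (f x) (unit_vec i) = form (f x) (f (unit_vec i))"
    using u assms by (auto simp: stab_def)
  also have "\<dots> = form x (unit_vec i)" by (rule stab_form) (use assms u \<open>x \<in> V\<close> \<open>0 \<in> S\<close> in auto)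
  also have "\<dots> = 0"
    unfolding form_sym[of x] by (rule form_flag_perp[OF assms(1) u(1) assms(4)])
  finally show "form (f x) (unit_vec i) = 0" .
qed

lemma orbit_even:
  assumes "j < m" shows "(\<lambda>f. f (unit_vec (2*j))) ` stab (flag j) = perp j - {0}"
proof (intro equalityI subsetI)
  have e: "unit_vec (2*j) \<in> perp j" "unit_vec (2*j) \<noteq> 0"
    using assms by (auto simp: unit_vec_in_perp fun_eq_iff unit_vec_apply)
  fix v
  { assume "v \<in> perp j - {0}"
    then have v: "v \<in> perp j" "v \<noteq> 0" by auto
    have "form s w = 0" if "s \<in> flag j" "w \<in> perp j" for s w
      using form_flag_perp[of j s w] that assms by simp
    then obtain f where "f \<in> stab (flag j)" "f (unit_vec (2*j)) = v"
      by (rule stab_transitive[OF _ e v])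
    then show "v \<in> (\<lambda>f. f (unit_vec (2*j))) ` stab (flag j)" by auto }
  { assume "v \<in> (\<lambda>f. f (unit_vec (2*j))) ` stab (flag j)"
    then obtain f where f: "f \<in> stab (flag j)" "v = f (unit_vec (2*j))" by auto
    then have "f 0 = 0" "bij f" by (auto simp: stab_def flag_def affine_symplectic_bij)
    then have "v \<noteq> 0" using e f by (metis bij_inv_eq_iff)
    then show "v \<in> perp j - {0}" using stab_flag_perp[OF _ _ f(1)] e f assms by auto }
qed

lemma orbit_odd:
  assumes "j < m"
  shows "(\<lambda>f. f (unit_vec (Suc (2*j)))) ` stab (insert (unit_vec (2*j)) (flag j)) =
    {u\<in>perp j. u (Suc (2*j)) = 1}"
proof (intro equalityI subsetI)
  let ?e = "unit_vec (2*j)" and ?f = "unit_vec (Suc (2*j))"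
  let ?S = "insert ?e (flag j)"
  have e: "?e \<in> perp j" "?f \<in> perp j" "?e \<in> V" "?f \<in> V"
    using assms by (auto simp: unit_vec_in_perp unit_vec_in_V)
  have form_e: "form x ?e = x (Suc (2*j))" for x
    using assms by (simp add: form_unit_vec partner_def)
  have stabI: "transvection 0 w \<in> stab ?S" if "w \<in> perp j" "form w ?e = 0" for w
  proof (rule transvection_in_stab)
    show "w \<in> V" using that perp_subset by auto
    show "form s w = 0" if "s \<in> ?S" for s
      using that \<open>form w ?e = 0\<close> form_flag_perp[OF _ _ \<open>w \<in> perp j\<close>, of s] assms
      by (auto simp: form_sym[of ?e])
  qed
  have ef: "form ?e ?f = 1" "form ?f ?e = 1" by (simp_all add: form_sym[of ?e] form_e unit_vec_apply)
  fix v
  { assume "v \<in> {u\<in>perp j. u (Suc (2*j)) = 1}"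
    then have v: "v \<in> perp j" "v \<in> V" "form v ?e = 1" using perp_subset by (auto simp: form_e)
    show "v \<in> (\<lambda>f. f ?f) ` stab ?S"
    proof (cases "form ?f v = 1")
      case True
      have "transvection 0 (?f + v) \<in> stab ?S"
        by (rule stabI) (use v e ef in \<open>auto simp: perp_add form_add\<close>)
      moreover have "transvection 0 (?f + v) ?f = v"
        using e True by (simp add: transvection_def form_add)
      ultimately show ?thesis by (metis imageI)
    next
      case False
      have "form ?e v = 1" using v form_sym by metis
      have 1: "transvection 0 ?e \<in> stab ?S" by (rule stabI) (use e in auto)
      have 2: "transvection 0 (?e + ?f + v) \<in> stab ?S"
        by (rule stabI) (use v e ef in \<open>auto simp: perp_add form_add\<close>)
      have "transvection 0 ?e ?f = ?e + ?f"
        using e ef by (simp add: transvection_def add.commute)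
      moreover have "form (?e + ?f + 0) (?e + ?f + v) = 1"
        using ef False \<open>form ?e v = 1\<close> by (simp add: form_add)
      then have "transvection 0 (?e + ?f + v) (?e + ?f) = v"
        using e by (simp only: transvection_def add_in_V bit_vec_add_self if_True simp_thms)
      ultimately have "(transvection 0 (?e + ?f + v) \<circ> transvection 0 ?e) ?f = v" by simp
      then show ?thesis using stab_comp[OF 2 1] by (metis imageI)
    qed }
  { assume "v \<in> (\<lambda>f. f ?f) ` stab ?S"
    then obtain f where f: "f \<in> stab ?S" "v = f ?f" by auto
    have "f ?e = ?e" using f by (simp add: stab_def)
    moreover have "form (f ?f) (f ?e) = form ?f ?e"
      by (rule stab_form[OF f(1)]) (use e in \<open>auto simp: flag_def\<close>)
    ultimately have "v (Suc (2*j)) = 1" using f ef form_e[of v] by simp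
    then show "v \<in> {u\<in>perp j. u (Suc (2*j)) = 1}"
      using stab_flag_perp[OF _ _ f(1), of j ?f] e f assms by auto }
qed

lemma card_perp: "j \<le> m \<Longrightarrow> card (perp j) = 2 ^ (2*(m-j))"
proof -
  have "perp j = {x. \<forall>i. i \<notin> {2*j..<2*m} \<longrightarrow> x i = 0}"
    by (auto simp: perp_def V_def not_less)
  then show ?thesis using card_bit_vec(2)[of "{2*j..<2*m}" "\<lambda>_. 0"] by (simp add: right_diff_distrib')
qed

lemma card_perp_odd:
  assumes "j < m" shows "card {u\<in>perp j. u (Suc (2*j)) = 1} = 2 ^ (2*(m-j) - 1)"
proof -
  have "{u\<in>perp j. u (Suc (2*j)) = 1} =
    {x. \<forall>i. i \<notin> {2*j..<2*m} - {Suc (2*j)} \<longrightarrow> x i = unit_vec (Suc (2*j)) i}"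
    (is "?A = ?B")
  proof (intro equalityI subsetI)
    fix x assume x: "x \<in> ?A"
    have "x i = unit_vec (Suc (2*j)) i" if "i \<notin> {2*j..<2*m} - {Suc (2*j)}" for i
      using x that by (cases "i = Suc (2*j)") (auto simp: perp_def V_def unit_vec_apply not_less)
    then show "x \<in> ?B" by blast
  next
    fix x assume "x \<in> ?B"
    then have x: "x i = of_bool (i = Suc (2*j))" if "i = Suc (2*j) \<or> i < 2*j \<or> 2*m \<le> i" for i
      using that by (simp only: mem_Collect_eq unit_vec_apply) auto
    show "x \<in> ?A" using assms by (simp add: perp_def V_def x)
  qed
  moreover have "card ({2*j..<2*m} - {Suc (2*j)}) = 2*(m-j) - 1"
    using assms by (simp add: right_diff_distrib')
  ultimately show ?thesis
    using card_bit_vec(2)[of "{2*j..<2*m} - {Suc (2*j)}" "unit_vec (Suc (2*j))"] by simp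
qed

lemma flag_Suc: "flag (Suc j) = insert (unit_vec (Suc (2*j))) (insert (unit_vec (2*j)) (flag j))"
proof -
  have "{..<2 * Suc j} = insert (Suc (2*j)) (insert (2*j) {..<2*j})" by auto
  then show ?thesis by (auto simp: flag_def)
qed

lemma card_stab_flag:
  assumes "j < m"
  shows "card (stab (flag j)) = (2 ^ (2*(m-j)) - 1) * 2 ^ (2*(m-j) - 1) * card (stab (flag (Suc j)))"
proof -
  have "card (perp j - {0}) = 2 ^ (2*(m-j)) - 1"
    using card_perp[of j] assms by (subst card_Diff_singleton) (auto simp: perp_def)
  then show ?thesis
    using card_stab[of "flag j" "unit_vec (2*j)"]
      card_stab[of "insert (unit_vec (2*j)) (flag j)" "unit_vec (Suc (2*j))"]
    by (simp only: flag_Suc orbit_even[OF assms] orbit_odd[OF assms] card_perp_odd[OF assms] mult.assoc)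
qed

lemma fixes_V:
  assumes "f \<in> stab (flag m)" "x \<in> V" shows "f x = x"
proof (rule form_nondegenerate)
  show "f x \<in> V" "x \<in> V" using assms by (auto simp: stab_def affine_symplectic_in_V)
  fix j assume j: "j < 2*m"
  then have "f (unit_vec j) = unit_vec j" using assms by (auto simp: stab_def flag_def)
  moreover have "form (f x) (f (unit_vec j)) = form x (unit_vec j)"
    by (rule stab_form[OF assms(1)]) (use assms j in \<open>auto simp: flag_def unit_vec_in_V\<close>)
  ultimately show "form (f x) (unit_vec j) = form x (unit_vec j)" by simp
qed

lemma affine_symplectic_eqI:
  assumes "f \<in> affine_symplectic" "g \<in> affine_symplectic" "\<And>x. x \<in> V \<Longrightarrow> f x = g x"
  shows "f = g"
proof
  fix x show "f x = g x"
    using assms by (cases "x \<in> V") (auto simp: affine_symplectic_def permutes_not_in)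
qed

lemma card_stab_flag_top: "card (stab (flag m)) = 1"
proof -
  have "stab (flag m) = {\<lambda>x. x}"
    using fixes_V id_in_affine_symplectic
    by (auto intro!: affine_symplectic_eqI simp: stab_def)
  then show ?thesis by simp
qed

lemma card_affine_symplectic:
  "card affine_symplectic = 2 ^ (2*m) * (\<Prod>i<m. (2 ^ (2 * Suc i) - 1) * 2 ^ (2*i + 1))"
proof -
  have "j \<le> m \<Longrightarrow> card (stab (flag (m - j))) = (\<Prod>i<j. (2 ^ (2 * Suc i) - 1) * 2 ^ (2*i + 1))" for j
  proof (induction j)
    case 0
    then show ?case using card_stab_flag_top by simp
  next
    case (Suc j)
    then have "m - Suc j < m" "m - (m - Suc j) = Suc j" "Suc (m - Suc j) = m - j" by auto
    then show ?case using card_stab_flag[of "m - Suc j"] Suc by (simp add: mult.commute)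
  qed
  from this[of m] have 1: "card (stab (flag 0)) = (\<Prod>i<m. (2 ^ (2 * Suc i) - 1) * 2 ^ (2*i + 1))" by simp
  have 2: "stab {} = affine_symplectic" "flag 0 = insert 0 {}" by (auto simp: stab_def flag_def)
  show ?thesis using card_stab[of "{}" 0] 1 2 orbit_zero card_V by simp
qed

lemma doubly_transitive:
  assumes V: "a \<in> V" "b \<in> V" "c \<in> V" and "b \<noteq> a" "c \<noteq> a"
  obtains f where "f \<in> affine_symplectic" "f a = a" "f b = c"
proof -
  have perp: "x \<in> V \<Longrightarrow> x \<in> perp 0" for x by (simp add: perp_def)
  obtain f where f: "f \<in> stab {0}" "f (b + a) = c + a"
    using stab_transitive[of "{0}" 0 "b + a" "c + a"] perp assms by auto
  let ?t = "translation a"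
  have t: "?t \<in> affine_symplectic" using translation_in V by simp
  have f': "f \<in> affine_symplectic" "f 0 = 0" using f by (auto simp: stab_def)
  show thesis
  proof (rule that)
    show "?t \<circ> f \<circ> ?t \<in> affine_symplectic" using t f' affine_symplectic_comp by blast
    show "(?t \<circ> f \<circ> ?t) a = a" using V f' by (simp add: translation_def)
    have "?t b = b + a" using V by (simp add: translation_def)
    moreover have "?t (c + a) = c" using V by (simp add: translation_def add.assoc)
    ultimately show "(?t \<circ> f \<circ> ?t) b = c" using f by simp
  qed
qed

lemma transitive:
  assumes "x \<in> V" "y \<in> V" shows "\<exists>f\<in>affine_symplectic. f x = y"
  using assms by (intro bexI[of _ "translation (x + y)"] translation_in) (auto simp: translation_def)

lemma block_eq_V:
  assumes "B \<subseteq> V" "\<And>f. f \<in> affine_symplectic \<Longrightarrow> f ` B = B \<or> f ` B \<inter> B = {}"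
    and "a \<in> B" "b \<in> B" "a \<noteq> b"
  shows "B = V"
proof (intro equalityI subsetI)
  fix c assume "c \<in> V"
  show "c \<in> B"
  proof (cases "c = a")
    case False
    have "a \<in> V" "b \<in> V" using assms by auto
    then obtain f where f: "f \<in> affine_symplectic" "f a = a" "f b = c"
      using \<open>c \<in> V\<close> assms(5)[symmetric] False by (rule doubly_transitive)
    then have "a \<in> f ` B" "c \<in> f ` B" using assms(3,4) by (metis imageI)+
    then show ?thesis using assms(2)[OF f(1)] assms(3) by auto
  qed (use assms in simp)
qed (use assms in auto)

lemma moves_point:
  assumes "w \<in> V" "w \<noteq> 0" "p \<in> V"
  obtains x where "x \<in> V" "transvection p w x \<noteq> x"
proof -
  obtain z where z: "z \<in> V" "form w z = 1"
    using ex_form_one[of w 0] assms by (auto simp: perp_def)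
  have "transvection p w (z + p) = z + p + w"
    using z assms by (simp add: transvection_def form_sym[of z] add.assoc)
  then show thesis using that[of "z + p"] z assms by simp
qed

text \<open>Fewer than \<open>2m + 1\<close> points lie in an affine hyperplane, which is fixed pointwise by a
  transvection; the normal vector \<open>w\<close> of the hyperplane is found by pigeonhole.\<close>

lemma card_separating:
  assumes "0 < m" "S \<subseteq> V" "\<And>f. f \<in> stab S \<Longrightarrow> (\<forall>x\<in>V. f x = x)"
  shows "2*m + 1 \<le> card S"
proof (rule ccontr)
  assume "\<not> 2*m + 1 \<le> card S"
  then have cS: "card S \<le> 2*m" by simp
  have fin: "finite S" using assms(2) finite_V by (rule finite_subset)
  obtain p where p: "p \<in> V" "card (S - {p}) < 2*m"
  proof (cases "S = {}")
    case True
    then show thesis using that[of 0] assms(1) by simp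
  next
    case False
    then obtain p where "p \<in> S" by auto
    then show thesis using that[of p] assms(2) cS fin by (metis card_Diff1_less order_less_le_trans subsetD)
  qed
  let ?h = "\<lambda>w. {s\<in>S - {p}. form (s + p) w = 1}"
  have "card (?h ` V) \<le> card (Pow (S - {p}))"
    by (rule card_mono) (use fin in auto)
  also have "\<dots> < card V" using p fin by (simp add: card_Pow card_V)
  finally have "\<not> inj_on ?h V" by (rule pigeonhole)
  then obtain u v where uv: "u \<in> V" "v \<in> V" "u \<noteq> v" "?h u = ?h v" by (auto simp: inj_on_def)
  let ?w = "u + v"
  have w: "?w \<in> V" "?w \<noteq> 0"
    using uv by simp_all
  have "form (s + p) ?w = 0" if "s \<in> S" for s
  proof (cases "s = p")
    case False
    then have "form (s + p) u = 1 \<longleftrightarrow> form (s + p) v = 1" using that uv(4) by blast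
    then have "form (s + p) u = form (s + p) v" by (cases "form (s + p) v") auto
    then show ?thesis by (simp add: form_add(2))
  qed simp
  then have "transvection p ?w \<in> stab S"
    using transvection_in w by (auto simp: stab_def transvection_def)
  moreover obtain x where "x \<in> V" "transvection p ?w x \<noteq> x"
    by (rule moves_point[OF w p(1)])
  ultimately show False using assms(3) by blast
qed

lemma card_flag: "card (flag m) = 2*m + 1"
proof -
  have "inj unit_vec" by (auto simp: inj_def unit_vec_def fun_eq_iff)
  then have "card (unit_vec ` {..<2*m}) = 2*m" by (simp add: card_image inj_on_subset)
  moreover have "0 \<notin> unit_vec ` {..<2*m}" by (auto simp: unit_vec_def fun_eq_iff)
  ultimately show ?thesis by (simp add: flag_def)
qed

end

sublocale symplectic_space \<subseteq> transformation_group V affine_symplectic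
proof
  fix f assume f: "f \<in> affine_symplectic"
  then show "bij_betw f V V" by (simp add: affine_symplectic_def permutes_imp_bij)
  show "\<exists>g\<in>affine_symplectic. \<forall>x\<in>V. g (f x) = x"
    using f affine_symplectic_bij[OF f]
    by (intro bexI[of _ "inv_into UNIV f"] affine_symplectic_inv) (simp_all add: bij_is_inj)
qed (simp_all add: id_in_affine_symplectic affine_symplectic_comp)

lemma (in symplectic_space) separating_iff:
  "separating S \<longleftrightarrow> S \<subseteq> V \<and> (\<forall>f\<in>stab S. \<forall>x\<in>V. f x = x)"
  by (auto simp: separating_def stab_def)

lemma ex_affine_symplectic_group:
  assumes "0 < m"
  shows "\<exists>G :: (nat \<Rightarrow> nat) set. primitive_group {..<4 ^ m} G \<and>
    card G = 4 ^ m * (\<Prod>i<m. (2 ^ (2 * Suc i) - 1) * 2 ^ (2*i + 1)) \<and>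
    base_size {..<4 ^ m} G = 2*m + 1"
proof -
  interpret symplectic_space m .
  have four: "2 ^ (2*m) = (4 ^ m :: nat)" by (simp add: power_mult)
  have flag: "separating (flag m)"
    unfolding separating_iff using fixes_V unit_vec_in_V by (auto simp: flag_def)
  have lower: "2*m + 1 \<le> card S" if "separating S" for S
    using that card_separating[OF assms] unfolding separating_iff by blast
  have "\<exists>G :: (nat \<Rightarrow> nat) set. primitive_group {..<card V} G \<and> card G = card affine_symplectic \<and>
      2*m + 1 \<le> base_size {..<card V} G \<and> base_size {..<card V} G \<le> card (flag m)"
    using ex_primitive_group_nat[of "2*m + 1" "flag m"] transitive block_eq_V affine_symplectic_eqI
      lower flag by blast
  then show ?thesis
    by (force simp: card_V card_affine_symplectic card_flag four)
qed

lemma symplectic_product_bounds: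
  fixes m :: nat
  defines "P \<equiv> (\<Prod>i<m. (2 ^ (2 * Suc i) - 1) * 2 ^ (2*i + 1) :: nat)"
  shows "(3/4) ^ m * 2 ^ (2*m^2 + m) \<le> real P" "real P \<le> 2 ^ (2*m^2 + m)"
proof -
  have "(3/4) ^ m * 2 ^ (2*m^2 + m) \<le> real (\<Prod>i<m. (2 ^ (2 * Suc i) - 1) * 2 ^ (2*i + 1)) \<and>
    real (\<Prod>i<m. (2 ^ (2 * Suc i) - 1) * 2 ^ (2*i + 1)) \<le> 2 ^ (2*m^2 + m)"
  proof (induction m)
    case (Suc m)
    define Q :: real where "Q = real (\<Prod>i<m. (2 ^ (2 * Suc i) - 1) * 2 ^ (2*i + 1))"
    define R :: real where "R = real (2 ^ (2 * Suc m) - 1 :: nat) * 2 ^ (2*m + 1)"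
    have "real (2 ^ (2 * Suc m) - 1 :: nat) = 2 ^ (2 * Suc m) - 1" by (subst of_nat_diff) simp_all
    moreover have "(4::real) \<le> 2 ^ (2 * Suc m)" by simp
    ultimately have R: "(3/4) * (2 ^ (2 * Suc m) * 2 ^ (2*m + 1)) \<le> R" "R \<le> 2 ^ (2 * Suc m) * 2 ^ (2*m + 1)"
      unfolding R_def mult.assoc[symmetric] by (intro mult_right_mono; simp)+
    have Q: "0 \<le> Q" unfolding Q_def by (rule of_nat_0_le_iff)
    have R': "0 \<le> R" unfolding R_def by (intro mult_nonneg_nonneg of_nat_0_le_iff) simp
    have e: "2 * (Suc m)^2 + Suc m = (2*m^2 + m) + (2 * Suc m + (2*m + 1))"
      by (simp add: power2_eq_square)
    have "(3/4) ^ m * 2 ^ (2*m^2 + m) * ((3/4) * (2 ^ (2 * Suc m) * 2 ^ (2*m + 1))) \<le> Q * R"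
      "Q * R \<le> 2 ^ (2*m^2 + m) * (2 ^ (2 * Suc m) * 2 ^ (2*m + 1))"
      by (rule mult_mono; use Suc[folded Q_def] R Q R' in simp)+
    moreover have "real (\<Prod>i<Suc m. (2 ^ (2 * Suc i) - 1) * 2 ^ (2*i + 1)) = Q * R"
      by (simp add: Q_def R_def)
    ultimately show ?case unfolding e power_add by (simp only: power_Suc mult_ac)
  qed simp
  then show "(3/4) ^ m * 2 ^ (2*m^2 + m) \<le> real P" "real P \<le> 2 ^ (2*m^2 + m)"
    unfolding P_def by auto
qed

lemma round_symplectic:
  fixes m :: nat
  assumes "0 < m"
  defines "c \<equiv> 4 ^ m * (\<Prod>i<m. (2 ^ (2 * Suc i) - 1) * 2 ^ (2*i + 1) :: nat)"
  shows "round (2 * (log 2 (real c) / log 2 (real (4 ^ m)))) = 2 * int m + 3"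
proof -
  define P where "P = (\<Prod>i<m. (2 ^ (2 * Suc i) - 1) * 2 ^ (2*i + 1) :: nat)"
  define e where "e = real (2*m^2 + m)"
  note bounds = symplectic_product_bounds[of m, folded P_def]
  have "0 < (3/4::real) ^ m * 2 ^ (2*m^2 + m)" by simp
  then have P: "0 < real P" using bounds(1) by linarith
  have "log 2 ((3/4) ^ m * 2 ^ (2*m^2 + m)) \<le> log 2 (real P)"
    using bounds(1) P by (subst log_le_cancel_iff) auto
  moreover have "log 2 ((3/4) ^ m * 2 ^ (2*m^2 + m)) = real m * log 2 (3/4) + e"
    by (simp add: log_mult log_nat_power e_def)
  moreover have "log 2 (1/2) < log 2 ((3/4)^2)"
    by (subst log_less_cancel_iff) (auto simp: power2_eq_square)
  then have "- 1 < 2 * log 2 (3/4)" by (simp add: log_nat_power log_divide)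
  then have "real m * (- 1/2) < real m * log 2 (3/4)"
    using assms(1) by (intro mult_strict_left_mono) auto
  ultimately have lower: "e - real m / 2 < log 2 (real P)" by simp
  have "log 2 (real P) \<le> log 2 (2 ^ (2*m^2 + m))"
    using bounds(2) P by (subst log_le_cancel_iff) auto
  then have upper: "log 2 (real P) \<le> e" by (simp add: log_nat_power e_def)
  have four: "log 2 (4 ^ m) = 2 * real m"
  proof -
    have "(4::real) ^ m = 2 ^ (2*m)" by (simp add: power_mult)
    then show ?thesis by (simp add: log_nat_power)
  qed
  have "real c = 4 ^ m * real P"
    unfolding c_def P_def[symmetric] by simp
  then have "log 2 (real c) = 2 * real m + log 2 (real P)"
    using P by (simp add: log_mult four)
  then have x: "2 * (log 2 (real c) / log 2 (real (4 ^ m))) = 2 + log 2 (real P) / m"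
    using assms(1) by (simp add: four field_simps)
  have "e / m = 2 * real m + 1" using assms(1) by (simp add: e_def power2_eq_square field_simps)
  moreover have "(e - real m / 2) / m < log 2 (real P) / m" "log 2 (real P) / m \<le> e / m"
    using lower upper assms(1) by (auto intro: divide_strict_right_mono divide_right_mono)
  moreover have "(e - real m / 2) / m = e / m - 1/2" using assms(1) by (simp add: diff_divide_distrib)
  ultimately show ?thesis unfolding x by (intro round_unique') (simp add: abs_less_iff)
qed

lemma affine_symplectic_sequence:
  "\<exists>(N :: nat set) (\<Omega> :: nat \<Rightarrow> nat set) (H :: nat \<Rightarrow> (nat \<Rightarrow> nat) set).
        primitive_group_sequence N \<Omega> H \<and>
        (\<forall>n\<in>N. int (base_size (\<Omega> n) (H n)) =
                 round (2 * (log 2 (real (card (H n))) / log 2 (real n))) - 2) \<and>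
        (\<forall>m. \<exists>n\<in>N. m < base_size (\<Omega> n) (H n))"
proof -
  define N :: "nat set" where "N = (\<lambda>m. 4 ^ m) ` {m. 0 < m}"
  have "\<exists>G :: (nat \<Rightarrow> nat) set. primitive_group {..<n} G \<and>
      int (base_size {..<n} G) = round (2 * (log 2 (real (card G)) / log 2 (real n))) - 2 \<and>
      (\<forall>m. n = 4 ^ m \<longrightarrow> base_size {..<n} G = 2*m + 1)" if n: "n \<in> N" for n
  proof -
    obtain m where m: "0 < m" "n = 4 ^ m" using n by (auto simp: N_def)
    obtain G :: "(nat \<Rightarrow> nat) set" where "primitive_group {..<4 ^ m} G"
      "card G = 4 ^ m * (\<Prod>i<m. (2 ^ (2 * Suc i) - 1) * 2 ^ (2*i + 1))"
      "base_size {..<4 ^ m} G = 2*m + 1"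
      using ex_affine_symplectic_group[OF m(1)] by blast
    then show ?thesis using round_symplectic[OF m(1)] m by (intro exI[of _ G]) auto
  qed
  then obtain H :: "nat \<Rightarrow> (nat \<Rightarrow> nat) set" where
    H: "\<And>n. n \<in> N \<Longrightarrow> primitive_group {..<n} (H n)"
      "\<And>n. n \<in> N \<Longrightarrow> int (base_size {..<n} (H n)) =
        round (2 * (log 2 (real (card (H n))) / log 2 (real n))) - 2"
      "\<And>m. 4 ^ m \<in> N \<Longrightarrow> base_size {..<4 ^ m} (H (4 ^ m)) = 2*m + 1"
    by metis
  have "infinite N"
  proof (unfold infinite_nat_iff_unbounded_le, intro allI)
    fix m :: nat
    have "m < 4 ^ m" by (induction m) auto
    also have "\<dots> < 4 ^ Suc m" by simp
    finally show "\<exists>n\<ge>m. n \<in> N" unfolding N_def by (meson imageI less_imp_le mem_Collect_eq zero_less_Suc)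
  qed
  then have "primitive_group_sequence N (\<lambda>n. {..<n}) H"
    using H(1) by (auto simp: primitive_group_sequence_def N_def)
  moreover have "\<exists>n\<in>N. m < base_size {..<n} (H n)" for m
  proof -
    have "4 ^ Suc m \<in> N" unfolding N_def by blast
    then show ?thesis using H(3)[of "Suc m"] by (intro bexI[of _ "4 ^ Suc m"]) auto
  qed
  ultimately show ?thesis using H(2) by (intro exI[of _ N] exI[of _ "\<lambda>n. {..<n}"] exI[of _ H]) simp
qed

theorem proposition1p2:
  shows
    "(\<forall>k::nat. 0 < k \<longrightarrow>
        (\<exists>(N :: nat set) (\<Omega> :: nat \<Rightarrow> nat set) (G :: nat \<Rightarrow> (nat \<Rightarrow> nat) set).
           primitive_group_sequence N \<Omega> G \<and>
           ((\<lambda>n. real (base_size (\<Omega> n) (G n)) * log 2 (real n) / log 2 (real (card (G n))))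
              \<longlongrightarrow> 2 * real k / (real k + 1)) (inf at_top (principal N))))
     \<and>
     (\<exists>(N :: nat set) (\<Omega> :: nat \<Rightarrow> nat set) (H :: nat \<Rightarrow> (nat \<Rightarrow> nat) set).
        primitive_group_sequence N \<Omega> H \<and>
        (\<forall>n\<in>N. int (base_size (\<Omega> n) (H n)) =
                 round (2 * (log 2 (real (card (H n))) / log 2 (real n))) - 2) \<and>
        (\<forall>m. \<exists>n\<in>N. m < base_size (\<Omega> n) (H n)))"
  using subset_group_sequence affine_symplectic_sequence by blast

end
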